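(* Let $k$ be a field of characteristic zero and let $H:\ 1, h_1=r, h_2, \dots, h_e, h_{e+1}=0$ be an $O$-sequence (the Hilbert function of some standard graded artinian $k$-algebra in $r$ variables). Let $t$ be the smallest integer such that $h_t \le t$. Then all standard graded artinian $k$-algebras $A=k[x_1,\dots,x_r]/I$ having Hilbert function $H$ enjoy the Maximal Rank Property if and only if either (i) $r=2$; or (ii) $r>2$, $h_t\le 2$, and for all indices $i=1,2,\dots,t-1$ we have $h_{i-1}=((h_i)_{(i)})^{-1}_{-1}$.
   Context: $R=k[x_1,\dots,x_r]$ is the standard graded polynomial ring ($\deg x_i=1$) over a field $k$ of characteristic zero; a standard graded algebra is $A=R/I$ with $I$ a homogeneous ideal, and its Hilbert function is $H(A,d)=\dim_k A_d$; $A$ is artinian if its Hilbert function is eventually $0$. An $O$-sequence is a sequence that occurs as the Hilbert function of a standard graded $k$-algebra (characterized by Macaulay's theorem). A property holds for a "general" form if it holds for all forms whose coefficients lie in a nonempty Zariski-open subset of the relevant space of forms. $A$ has the Maximal Rank Property (MRP) if for every $d\ge 1$ and a general form $F$ of degree $d$, the multiplication map $\times F: A_i\to A_{i+d}$ has maximal rank (is injective or surjective) for all $i\ge 0$. Notation: for positive integers $n,d$, the $d$-binomial expansion of $n$ is the unique expression $n=\binom{n_d}{d}+\binom{n_{d-1}}{d-1}+\cdots+\binom{n_j}{j}$ with $n_d>n_{d-1}>\dots>n_j\ge j\ge 1$; then $(n_{(d)})^{-1}_{-1}=\binom{n_d-1}{d-1}+\binom{n_{d-1}-1}{d-2}+\cdots+\binom{n_j-1}{j-1}$,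 with the convention $\binom{m}{n}=0$ if $m<n$ or $n<0$.
   Formalization: The formal theorem assumes r ≥ 2; for r = 1 (e.g. H: 1,1,0 with A = k[x]/(x²)) every algebra has the Maximal Rank Property although neither (i) nor (ii) holds, so the stated equivalence fails there (and likewise for r = 0). *)

theory Defs
  imports Main "HOL-Library.Poly_Mapping"
begin

text \<open>Polynomials over a field 'k: finitely supported maps from exponent vectors
  (nat \<Rightarrow>0 nat, variable x_i has index i) to coefficients.  The polynomial ring
  R = k[x_0,...,x_(r-1)] consists of those involving only variables of index < r.\<close>

type_synonym 'k mpoly = "(nat \<Rightarrow>\<^sub>0 nat) \<Rightarrow>\<^sub>0 'k"

definition mdeg :: "(nat \<Rightarrow>\<^sub>0 nat) \<Rightarrow> nat" where
  "mdeg \<alpha> = (\<Sum>i\<in>Poly_Mapping.keys \<alpha>. Poly_Mapping.lookup \<alpha> i)"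

definition polys :: "nat \<Rightarrow> ('k::zero) mpoly set" where
  "polys r = {f. \<forall>\<alpha>\<in>Poly_Mapping.keys f. Poly_Mapping.keys \<alpha> \<subseteq> {..<r}}"

definition forms :: "nat \<Rightarrow> nat \<Rightarrow> ('k::zero) mpoly set" where
  "forms r d = {f. \<forall>\<alpha>\<in>Poly_Mapping.keys f. Poly_Mapping.keys \<alpha> \<subseteq> {..<r} \<and> mdeg \<alpha> = d}"

definition const :: "'k::zero \<Rightarrow> 'k mpoly" where
  "const c = Poly_Mapping.single 0 c"

definition hcomp :: "nat \<Rightarrow> ('k::zero) mpoly \<Rightarrow> 'k mpoly" where
  "hcomp d f = Abs_poly_mapping (\<lambda>\<alpha>. if mdeg \<alpha> = d then Poly_Mapping.lookup f \<alpha> else 0)"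

definition homogeneous_ideal :: "nat \<Rightarrow> ('k::field) mpoly set \<Rightarrow> bool" where
  "homogeneous_ideal r I \<longleftrightarrow> I \<subseteq> polys r \<and> 0 \<in> I
     \<and> (\<forall>f\<in>I. \<forall>g\<in>I. f + g \<in> I)
     \<and> (\<forall>f\<in>I. \<forall>g\<in>polys r. g * f \<in> I)
     \<and> (\<forall>f\<in>I. \<forall>d. hcomp d f \<in> I)"

text \<open>B \<subseteq> R_d is (the set of representatives of) a k-basis of A_d = R_d / I_d.\<close>
definition basis_mod :: "nat \<Rightarrow> ('k::field) mpoly set \<Rightarrow> nat \<Rightarrow> 'k mpoly set \<Rightarrow> bool" where
  "basis_mod r I d B \<longleftrightarrow> finite B \<and> B \<subseteq> forms r d
     \<and> (\<forall>c. (\<Sum>b\<in>B. const (c b) * b) \<in> I \<longrightarrow> (\<forall>b\<in>B. c b = 0))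
     \<and> (\<forall>f\<in>forms r d. \<exists>c. f - (\<Sum>b\<in>B. const (c b) * b) \<in> I)"

definition hilb :: "nat \<Rightarrow> ('k::field) mpoly set \<Rightarrow> nat \<Rightarrow> nat" where
  "hilb r I d = (LEAST n. \<exists>B. basis_mod r I d B \<and> card B = n)"

definition artinian :: "nat \<Rightarrow> ('k::field) mpoly set \<Rightarrow> bool" where
  "artinian r I \<longleftrightarrow> (\<exists>N. \<forall>d\<ge>N. hilb r I d = 0)"

text \<open>Polynomials in the coefficients of a form (variables indexed by monomials),
  and their evaluation at the coefficient vector of a form.\<close>
definition eval_coeff :: "(((nat \<Rightarrow>\<^sub>0 nat) \<Rightarrow>\<^sub>0 nat) \<Rightarrow>\<^sub>0 'k) \<Rightarrow> 'k mpoly \<Rightarrow> ('k::comm_ring_1)" where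
  "eval_coeff P F = (\<Sum>m\<in>Poly_Mapping.keys P. Poly_Mapping.lookup P m * (\<Prod>\<alpha>\<in>Poly_Mapping.keys m. Poly_Mapping.lookup F \<alpha> ^ Poly_Mapping.lookup m \<alpha>))"

text \<open>A property holds for a general form of degree d in r variables if it holds on a
  nonempty Zariski-open subset of the affine space of such forms; equivalently (every
  nonempty open set contains a nonempty basic open set) on the non-vanishing locus of
  some polynomial in the coefficients that does not vanish identically on the forms.\<close>
definition general_form :: "nat \<Rightarrow> nat \<Rightarrow> (('k::comm_ring_1) mpoly \<Rightarrow> bool) \<Rightarrow> bool" where
  "general_form r d P \<longleftrightarrow> (\<exists>Q. (\<exists>F0\<in>forms r d. eval_coeff Q F0 \<noteq> 0)
      \<and> (\<forall>F\<in>forms r d. eval_coeff Q F \<noteq> 0 \<longrightarrow> P F))"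

definition mult_max_rank :: "nat \<Rightarrow> ('k::field) mpoly set \<Rightarrow> 'k mpoly \<Rightarrow> nat \<Rightarrow> nat \<Rightarrow> bool" where
  "mult_max_rank r I F d i \<longleftrightarrow>
     (\<forall>g\<in>forms r i. F * g \<in> I \<longrightarrow> g \<in> I)
     \<or> (\<forall>h\<in>forms r (i + d). \<exists>g\<in>forms r i. h - F * g \<in> I)"

definition MRP :: "nat \<Rightarrow> ('k::field) mpoly set \<Rightarrow> bool" where
  "MRP r I \<longleftrightarrow> (\<forall>d\<ge>1. general_form r d (\<lambda>F. \<forall>i. mult_max_rank r I F d i))"

definition binom_expansion :: "nat \<Rightarrow> nat \<Rightarrow> nat \<Rightarrow> (nat \<Rightarrow> nat) \<Rightarrow> bool" where
  "binom_expansion n d j a \<longleftrightarrow> 1 \<le> j \<and> j \<le> d \<and> j \<le> a j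
     \<and> (\<forall>i\<in>{j..<d}. a i < a (Suc i))
     \<and> n = (\<Sum>i=j..d. a i choose i)"

definition macaulay_mm :: "nat \<Rightarrow> nat \<Rightarrow> nat" where
  "macaulay_mm n d = (THE v. \<exists>j a. binom_expansion n d j a \<and> v = (\<Sum>i=j..d. (a i - 1) choose (i - 1)))"

end

theory Submission
  imports Defs "HOL-Library.Function_Algebras" "HOL-Computational_Algebra.Polynomial"
begin

text \<open>
  Multiplication \<open>F : A\<^sub>i \<rightarrow> A\<^sub>i\<^sub>+\<^sub>d\<close> is dual to the contraction by \<open>F\<close> on the inverse system of the
  ideal. Green's hyperplane restriction theorem says that contraction by a general linear form
  maps a space of dimension \<open>c\<close> in degree \<open>d\<close> onto a space of dimension at least
  \<open>macaulay_mm c d\<close>. Products of general linear forms then have maximal rank: in two variables, and in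
  degrees where the Hilbert function is at most 2, because \<open>macaulay_mm c d \<ge> min c d\<close>, and below
  degree \<open>t\<close> because the Hilbert function is extremal there.

  Conversely, Green's theorem implies Macaulay's bound, so the lexicographic ideal with the given
  Hilbert function exists. If \<open>h\<^sub>i\<^sub>-\<^sub>1\<close> is not extremal for some \<open>i < t\<close>, it has a socle element in degree
  \<open>i - 1\<close>, while surjectivity onto degree \<open>i\<close> fails already modulo all but two variables. If
  \<open>h\<^sub>t \<ge> 3\<close>, multiplication from degree 1 to degree \<open>t\<close> has rank at most 2.
\<close>

subsection \<open>Binomial expansions\<close>

text \<open>Maximal rank is an open condition on the coefficients of \<open>F\<close>, and an
  artinian algebra leaves only finitely many degrees to test. So one form of the required rank for
  each pair of degrees suffices, and that form may be special, such as a product of linear forms.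
  The obstacle in Green's theorem is that the kernel of \<open>h\<close> moves with
  \<open>h\<close>, so semicontinuity of rank does not apply to the restriction of \<open>g\<close>
  to it. The rank of the pair of contractions by \<open>h\<close> and \<open>g\<close> on the fixed
  space \<open>V\<close> is used instead. With \<open>c\<close> the dimension of \<open>V\<close>
  and \<open>\<rho>\<close> the largest rank, the geometry yields
  \<open>mac (Suc e) (c - \<rho>) + mac e \<rho> \<le> \<rho>\<close>, and arithmetic has to turn
  this into \<open>mac (Suc e) c \<le> \<rho>\<close>. It can, because \<open>mac\<close> grows by 0
  or 1 at each step, so that both \<open>mac d n\<close> and \<open>n - mac d n\<close> are monotone
  in \<open>n\<close>.\<close>

text \<open>The number of monomials of degree \<open>d\<close> in \<open>k\<close> variables.
  Indexing by variables makes Pascal's rule the removal of the last variable.\<close>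

definition mcount :: "nat \<Rightarrow> nat \<Rightarrow> nat" where
  "mcount k d = (k + d - 1) choose d"

lemma mcount_0_right [simp]: "mcount k 0 = 1"
  by (simp add: mcount_def)

lemma mcount_0_left [simp]: "mcount 0 (Suc d) = 0"
  by (simp add: mcount_def)

lemma mcount_Suc_Suc: "mcount (Suc k) (Suc d) = mcount k (Suc d) + mcount (Suc k) d"
  by (simp add: mcount_def)

lemma mcount_1 [simp]: "mcount (Suc 0) d = 1"
  by (simp add: mcount_def)

lemma mcount_2: "mcount 2 d = Suc d"
  by (simp add: mcount_def)

lemma mcount_deg_1: "mcount k (Suc 0) = k"
  by (simp add: mcount_def)

lemma mcount_mono: "k \<le> l \<Longrightarrow> mcount k d \<le> mcount l d"
  unfolding mcount_def by (intro binomial_right_mono) auto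

lemma mcount_pos: "0 < mcount (Suc k) d"
  by (simp add: mcount_def)

lemma le_mcount: "k \<le> mcount k (Suc d)"
proof (induction k)
  case (Suc k)
  then show ?case using mcount_pos[of k d] by (simp add: mcount_Suc_Suc)
qed simp

text \<open>The index is shifted, so that \<open>lead d\<close> belongs to degree
  \<open>Suc d\<close>: in degree 0 every \<open>mcount k 0\<close> is 1, and for positive
  \<open>n\<close> no greatest \<open>k\<close> would exist.\<close>

definition lead :: "nat \<Rightarrow> nat \<Rightarrow> nat" where
  "lead d n = (GREATEST k. mcount k (Suc d) \<le> n)"

lemma mcount_lead_le: "mcount (lead d n) (Suc d) \<le> n"
  and lead_ge: "mcount k (Suc d) \<le> n \<Longrightarrow> k \<le> lead d n"
proof -
  have bd: "\<forall>k. mcount k (Suc d) \<le> n \<longrightarrow> k \<le> n"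
    using le_mcount order_trans by blast
  show "mcount (lead d n) (Suc d) \<le> n"
    unfolding lead_def by (rule GreatestI_nat[of "\<lambda>k. mcount k (Suc d) \<le> n" 0 n]) (use bd in auto)
  show "mcount k (Suc d) \<le> n \<Longrightarrow> k \<le> lead d n"
    unfolding lead_def by (rule Greatest_le_nat[of "\<lambda>k. mcount k (Suc d) \<le> n" k n]) (use bd in auto)
qed

lemma less_mcount_Suc_lead: "n < mcount (Suc (lead d n)) (Suc d)"
  using lead_ge[of "Suc (lead d n)" d n] by (meson not_less not_less_eq_eq order_refl)

lemma lead_eqI:
  assumes "z < mcount (Suc k) d"
  shows "lead d (mcount k (Suc d) + z) = k"
proof (rule antisym)
  show "k \<le> lead d (mcount k (Suc d) + z)" by (rule lead_ge) simp
  show "lead d (mcount k (Suc d) + z) \<le> k"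
  proof (rule ccontr)
    assume "\<not> ?thesis"
    then have "mcount (Suc k) (Suc d) \<le> mcount (lead d (mcount k (Suc d) + z)) (Suc d)"
      by (intro mcount_mono) simp
    also have "\<dots> \<le> mcount k (Suc d) + z" by (rule mcount_lead_le)
    finally show False using assms by (simp add: mcount_Suc_Suc)
  qed
qed

lemma lead_decomp:
  obtains z where "n = mcount (lead d n) (Suc d) + z" "z < mcount (Suc (lead d n)) d"
proof
  show "n = mcount (lead d n) (Suc d) + (n - mcount (lead d n) (Suc d))"
    using mcount_lead_le[of d n] by simp
  show "n - mcount (lead d n) (Suc d) < mcount (Suc (lead d n)) d"
    using less_mcount_Suc_lead[of n d] mcount_lead_le[of d n] by (simp add: mcount_Suc_Suc)
qed

text \<open>\<open>mac d n\<close> is the number \<open>macaulay_mm n d\<close>, computed by the greedy binomial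
  expansion; the top entry of the expansion in degree \<open>d + 1\<close> is \<open>lead d n + d\<close>.\<close>

fun mac :: "nat \<Rightarrow> nat \<Rightarrow> nat" where
  "mac 0 n = 0"
| "mac (Suc d) n = (if n = 0 then 0
     else mcount (lead d n) d + mac d (n - mcount (lead d n) (Suc d)))"

declare mac.simps(2) [simp del]

lemma mac_0 [simp]: "mac d 0 = 0"
  by (cases d) (auto simp: mac.simps(2))

lemma mac_cascade_less:
  assumes "z < mcount (Suc k) d" "0 < mcount k (Suc d) + z"
  shows "mac (Suc d) (mcount k (Suc d) + z) = mcount k d + mac d z"
  using assms by (auto simp: mac.simps(2) lead_eqI)

lemma mac_mcount: "mac (Suc d) (mcount (Suc k) (Suc d)) = mcount (Suc k) d"
  using mac_cascade_less[of 0 "Suc k" d] mcount_pos by simp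

text \<open>At the boundary \<open>z = mcount (Suc k) d\<close> the greedy expansion has top
  \<open>Suc k\<close> instead of \<open>k\<close>, but Pascal's rule gives the same value. With the
  boundary included, \<open>z\<close> and \<open>Suc z\<close> can be treated with the same
  \<open>k\<close>.\<close>

lemma mac_cascade:
  assumes "z \<le> mcount (Suc k) d" "0 < mcount k (Suc d) + z"
  shows "mac (Suc d) (mcount k (Suc d) + z) = mcount k d + mac d z"
proof (cases "z = mcount (Suc k) d")
  case True
  have "mac (Suc d) (mcount k (Suc d) + z) = mcount (Suc k) d"
    using True mac_mcount[of d k] by (simp add: mcount_Suc_Suc)
  also have "\<dots> = mcount k d + mac d z"
  proof (cases d)
    case (Suc e)
    then show ?thesis using True mac_mcount[of e k] by (simp add: mcount_Suc_Suc)
  qed simp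
  finally show ?thesis .
next
  case False
  then show ?thesis using mac_cascade_less assms by simp
qed

lemma mac_1: "mac (Suc d) (Suc 0) = 1"
  using mac_mcount[of d 0] by simp

text \<open>Peeling off the top binomial of \<open>n\<close> leaves the same claim for the
  remainder, one degree lower.\<close>

lemma mac_Suc: "mac d n \<le> mac d (Suc n) \<and> mac d (Suc n) \<le> Suc (mac d n)"
proof (induction d arbitrary: n)
  case (Suc d)
  show ?case
  proof (cases "n = 0")
    case True
    then show ?thesis using mac_1 by simp
  next
    case False
    obtain z where z: "n = mcount (lead d n) (Suc d) + z" "z < mcount (Suc (lead d n)) d"
      by (rule lead_decomp)
    have "mac (Suc d) n = mcount (lead d n) d + mac d z"
      using mac_cascade[of z "lead d n" d] z False by simp
    moreover have "mac (Suc d) (Suc n) = mcount (lead d n) d + mac d (Suc z)"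
      using mac_cascade[of "Suc z" "lead d n" d] z by simp
    ultimately show ?thesis using Suc.IH[of z] by simp
  qed
qed simp

lemma mac_mono: "m \<le> n \<Longrightarrow> mac d m \<le> mac d n"
  using mac_Suc lift_Suc_mono_le[of "mac d"] by blast

lemma mac_le: "mac d n \<le> n"
proof (induction n)
  case (Suc n)
  then show ?case using mac_Suc[of d n] by linarith
qed simp

lemma diff_mac_mono: "m \<le> n \<Longrightarrow> m - mac d m \<le> n - mac d n"
proof (rule lift_Suc_mono_le[of "\<lambda>n. n - mac d n"])
  show "n - mac d n \<le> Suc n - mac d (Suc n)" for n
    using mac_Suc[of d n] mac_le[of d n] mac_le[of d "Suc n"] by linarith
qed

text \<open>Subtracting 1 only affects the last summand of the expansion, in degree 1, where
  \<open>mac\<close> is 1 for every positive number. Two variables keep that summand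
  positive.\<close>

lemma mac_pred_mcount:
  "mac (Suc d) (mcount (Suc (Suc k)) (Suc d) - 1) = mcount (Suc (Suc k)) d"
proof (induction d)
  case 0
  have "mcount (Suc (Suc k)) (Suc 0) - 1 = mcount (Suc k) (Suc 0)"
    by (simp add: mcount_deg_1)
  then show ?case using mac_mcount[of 0 k] by simp
next
  case (Suc d)
  let ?z = "mcount (Suc (Suc k)) (Suc d) - 1"
  have "mcount (Suc (Suc k)) (Suc (Suc d)) - 1 = mcount (Suc k) (Suc (Suc d)) + ?z"
    using mcount_pos[of "Suc k" "Suc d"] by (simp add: mcount_Suc_Suc[of "Suc k" "Suc d"])
  then have "mac (Suc (Suc d)) (mcount (Suc (Suc k)) (Suc (Suc d)) - 1) = mcount (Suc k) (Suc d) + mac (Suc d) ?z"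
    using mac_cascade[of ?z "Suc k" "Suc d"] mcount_pos[of k "Suc (Suc d)"] by simp
  then show ?case using Suc by (simp add: mcount_Suc_Suc[of "Suc k" d])
qed

text \<open>The case of \<open>mac_add_le\<close> below in which the second summand is one less than
  \<open>mac (Suc d) c\<close>; monotonicity reduces the general case to it.\<close>

lemma mac_split_ge:
  assumes "0 < c"
  shows "mac (Suc d) c \<le> mac (Suc d) (c - mac (Suc d) c + 1) + mac d (mac (Suc d) c - 1)"
  using assms
proof (induction d arbitrary: c)
  case 0
  have "mac (Suc 0) c = 1"
    using 0 mac_mcount[of 0 "c - 1"] by (simp add: mcount_deg_1)
  then show ?case using 0 by simp
next
  case (Suc f)
  obtain z where z: "c = mcount (lead (Suc f) c) (Suc (Suc f)) + z" "z < mcount (Suc (lead (Suc f) c)) (Suc f)"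
    by (rule lead_decomp)
  have "lead (Suc f) c \<ge> 1"
    using Suc.prems by (intro lead_ge) simp
  then obtain l where l: "lead (Suc f) c = Suc l" by (cases "lead (Suc f) c") auto
  have mc: "mac (Suc (Suc f)) c = mcount (Suc l) (Suc f) + mac (Suc f) z"
    using mac_cascade[of z "Suc l" "Suc f"] z l Suc.prems by simp
  \<comment> \<open>Subtracting \<open>mcount (Suc l) (Suc f)\<close> from the top term lowers its
    number of variables by one. It remains to see that the rest is small enough for
    \<open>mac_cascade\<close>.\<close>
  have up: "c - mac (Suc (Suc f)) c + 1 = mcount l (Suc (Suc f)) + (z - mac (Suc f) z + 1)"
    using z(1) l mc mac_le[of "Suc f" z] by (simp add: mcount_Suc_Suc[of l "Suc f"])
  show ?case
  proof (cases "z = 0")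
    case True
    have "mac (Suc (Suc f)) (c - mac (Suc (Suc f)) c + 1) = mcount l (Suc f) + mac (Suc f) 1"
      unfolding up using mac_cascade[of 1 l "Suc f"] True mcount_pos[of l "Suc f"] by simp
    then have a: "mac (Suc (Suc f)) (c - mac (Suc (Suc f)) c + 1) = mcount l (Suc f) + 1"
      using mac_1 by simp
    show ?thesis
    proof (cases l)
      case 0
      then show ?thesis using a mc True by simp
    next
      case (Suc k)
      then have "mac (Suc f) (mac (Suc (Suc f)) c - 1) = mcount (Suc l) f"
        using mac_pred_mcount[of f k] mc True by simp
      then show ?thesis using a mc True by (simp add: mcount_Suc_Suc)
    qed
  next
    case False
    let ?Z = "mcount (Suc (Suc l)) (Suc f)"
    \<comment> \<open>Monotonicity reduces to the largest possible \<open>z\<close>, namely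
      \<open>?Z - 1\<close>. There the bound \<open>le1\<close> is attained, so the boundary case of
      \<open>mac_cascade\<close> really occurs.\<close>
    have "z - mac (Suc f) z \<le> (?Z - 1) - mac (Suc f) (?Z - 1)"
      using z l by (intro diff_mac_mono) simp
    also have "\<dots> = ?Z - 1 - mcount (Suc (Suc l)) f"
      using mac_pred_mcount[of f l] by simp
    also have "\<dots> = mcount (Suc l) (Suc f) - 1"
      using mcount_Suc_Suc[of "Suc l" f] by simp
    finally have le1: "z - mac (Suc f) z + 1 \<le> mcount (Suc l) (Suc f)"
      using mcount_pos[of l "Suc f"] by linarith
    have "mac (Suc f) z \<le> mac (Suc f) ?Z"
      using z l by (intro mac_mono) simp
    then have le2: "mac (Suc f) z - 1 \<le> mcount (Suc (Suc l)) f"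
      using mac_mcount[of f "Suc l"] by simp
    have pos: "1 \<le> mac (Suc f) z"
      using mac_mono[of 1 z "Suc f"] False mac_1 by simp
    have "mac (Suc (Suc f)) (c - mac (Suc (Suc f)) c + 1) = mcount l (Suc f) + mac (Suc f) (z - mac (Suc f) z + 1)"
      unfolding up using mac_cascade[OF le1] by simp
    moreover have "mac (Suc (Suc f)) c - 1 = mcount (Suc l) (Suc f) + (mac (Suc f) z - 1)"
      using mc pos by simp
    then have "mac (Suc f) (mac (Suc (Suc f)) c - 1) = mcount (Suc l) f + mac f (mac (Suc f) z - 1)"
      using mac_cascade[OF le2] mcount_pos[of l "Suc f"] by simp
    ultimately show ?thesis
      using Suc.IH[of z] False mc by (simp add: mcount_Suc_Suc)
  qed
qed

text \<open>In Green's theorem \<open>b\<close> is the generic rank and \<open>a\<close> the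
  dimension of the kernel. If the claim fails, \<open>b\<close> can be raised to
  \<open>mac (Suc d) (a + b) - 1\<close> at the expense of \<open>a\<close>; both monotonicities
  preserve the hypothesis, and \<open>mac_split_ge\<close> contradicts it.\<close>

lemma mac_add_le:
  assumes "mac (Suc d) a + mac d b \<le> b"
  shows "mac (Suc d) (a + b) \<le> b"
proof (rule ccontr)
  assume less: "\<not> ?thesis"
  define c where "c = a + b"
  define b0 where "b0 = mac (Suc d) c - 1"
  have b: "b \<le> b0" and c: "0 < c" and m: "mac (Suc d) c = Suc b0"
    using less unfolding c_def b0_def by (auto intro: gr0I)
  have "c - mac (Suc d) c + 1 \<le> a"
    using b m c_def mac_le[of "Suc d" c] by linarith
  then have "mac (Suc d) (c - mac (Suc d) c + 1) \<le> mac (Suc d) a"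
    by (rule mac_mono)
  moreover have "b - mac d b \<le> b0 - mac d b0" using b by (rule diff_mac_mono)
  moreover have "Suc b0 \<le> mac (Suc d) (c - mac (Suc d) c + 1) + mac d b0"
    using mac_split_ge[OF c, of d] m by simp
  ultimately show False using assms mac_le[of d b] mac_le[of d b0] by linarith
qed

text \<open>All terms of the expansion are binomials \<open>i choose i\<close>, hence equal to 1
  before and after the shift.\<close>

lemma mac_small: "n \<le> d \<Longrightarrow> mac d n = n"
proof (induction d arbitrary: n)
  case (Suc d)
  show ?case
  proof (cases n)
    case (Suc m)
    have "mac (Suc d) (mcount (Suc 0) (Suc d) + m) = mcount (Suc 0) d + mac d m"
      using Suc.prems Suc mcount_2[of d] by (intro mac_cascade) (simp_all add: numeral_2_eq_2)
    then show ?thesis using Suc Suc.IH[of m] Suc.prems by simp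
  qed simp
qed simp

lemma mac_ge_min: "min n d \<le> mac d n"
  using mac_mono[of "min n d" n d] mac_small[of "min n d" d] by simp

section \<open>Agreement of the greedy recursion with binomial expansions\<close>

text \<open>Any expansion gives the value \<open>mac d n\<close>, which is the uniqueness behind the
  \<open>THE\<close> in \<open>macaulay_mm\<close>. The bounds serve the induction: the one on
  \<open>n\<close> shows that the tail of an expansion is an admissible remainder for
  \<open>mac_cascade\<close>.\<close>

lemma binom_expansion_mac:
  assumes "binom_expansion n d j a"
  shows "d \<le> a d \<and> 0 < n \<and> n < (a d + 1) choose d \<and> (\<Sum>i=j..d. (a i - 1) choose (i - 1)) = mac d n"
  using assms
proof (induction d arbitrary: n)
  case 0
  then show ?case by (auto simp: binom_expansion_def)
next
  case (Suc e)
  define z where "z = (\<Sum>i=j..e. a i choose i)"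
  have j: "1 \<le> j" "j \<le> Suc e" "j \<le> a j" and inc: "\<forall>i\<in>{j..<Suc e}. a i < a (Suc i)"
    and n: "n = (\<Sum>i=j..Suc e. a i choose i)"
    using Suc.prems by (auto simp: binom_expansion_def)
  have n2: "n = z + (a (Suc e) choose Suc e)"
    using n j z_def by simp
  have *: "Suc e \<le> a (Suc e) \<and> z < a (Suc e) choose e \<and> (\<Sum>i=j..e. (a i - 1) choose (i - 1)) = mac e z"
  proof (cases "j = Suc e")
    case True
    then show ?thesis using j by (simp add: z_def zero_less_binomial)
  next
    case False
    then have be: "binom_expansion z e j a"
      using j inc by (auto simp: binom_expansion_def z_def)
    have lt: "a e < a (Suc e)" using inc False j by auto
    have "(a e + 1) choose e \<le> a (Suc e) choose e" using lt by (intro binomial_right_mono) simp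
    then show ?thesis using Suc.IH[OF be] lt by auto
  qed
  \<comment> \<open>The number of variables whose monomials of degree \<open>Suc e\<close> are
    counted by the top binomial.\<close>
  define k where "k = a (Suc e) - e"
  have k: "a (Suc e) = k + e" and k1: "1 \<le> k" using * k_def by auto
  have 1: "mcount k (Suc e) = a (Suc e) choose Suc e" "mcount (Suc k) e = a (Suc e) choose e"
     "mcount k e = (a (Suc e) - 1) choose e"
    using k by (simp_all add: mcount_def)
  have pos: "0 < a (Suc e) choose Suc e" using * by (simp add: zero_less_binomial)
  have "mac (Suc e) (mcount k (Suc e) + z) = mcount k e + mac e z"
    using * 1 pos by (intro mac_cascade) auto
  then have "mac (Suc e) n = ((a (Suc e) - 1) choose e) + mac e z"
    using n2 1 by (simp add: add.commute)
  then have "(\<Sum>i=j..Suc e. (a i - 1) choose (i - 1)) = mac (Suc e) n"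
    using j * by simp
  moreover have "n < (a (Suc e) + 1) choose Suc e" using n2 * by simp
  ultimately show ?case using * n2 pos by simp
qed

lemma binom_expansion_exists:
  assumes "0 < n" "0 < d"
  shows "\<exists>j a. binom_expansion n d j a"
  using assms
proof (induction d arbitrary: n)
  case (Suc e)
  obtain z where z: "n = mcount (lead e n) (Suc e) + z" "z < mcount (Suc (lead e n)) e"
    by (rule lead_decomp)
  define k where "k = lead e n"
  have k: "1 \<le> k" unfolding k_def using Suc.prems by (intro lead_ge) simp
  have nz: "n = ((k + e) choose Suc e) + z" "z < (k + e) choose e"
    using z by (simp_all add: k_def mcount_def)
  show ?case
  \<comment> \<open>A zero remainder has to end the expansion at \<open>j = Suc e\<close>, because
    its last entry must satisfy \<open>j \<le> a j\<close>.\<close>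
  proof (cases "z = 0")
    case True
    have "binom_expansion n (Suc e) (Suc e) (\<lambda>_. k + e)"
      using nz k True by (auto simp: binom_expansion_def)
    then show ?thesis by blast
  next
    case False
    then have e: "0 < e" using nz by (cases e) auto
    obtain j a where ja: "binom_expansion z e j a" using Suc.IH False e by blast
    have "a e choose e \<le> z"
      using ja by (auto simp: binom_expansion_def intro: member_le_sum)
    then have lt: "a e < k + e"
      using nz(2) binomial_right_mono[of "k + e" "a e" e] by (meson not_less order_le_less_trans order_less_irrefl)
    have "binom_expansion n (Suc e) j (a(Suc e := k + e))"
      using ja lt nz unfolding binom_expansion_def
      by (auto simp: less_Suc_eq intro!: sum.cong)
    then show ?thesis by blast
  qed
qed simp

lemma macaulay_mm_eq_mac:
  assumes "0 < n" "0 < d"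
  shows "macaulay_mm n d = mac d n"
proof -
  obtain j a where "binom_expansion n d j a" using binom_expansion_exists[OF assms] by blast
  then show ?thesis unfolding macaulay_mm_def
    using binom_expansion_mac by (intro the_equality) metis+
qed

subsection \<open>Lexicographic segments of monomials\<close>

definition mons :: "nat \<Rightarrow> nat \<Rightarrow> (nat \<Rightarrow>\<^sub>0 nat) set" where
  "mons r d = {\<alpha>. Poly_Mapping.keys \<alpha> \<subseteq> {..<r} \<and> mdeg \<alpha> = d}"

abbreviation evar :: "nat \<Rightarrow> (nat \<Rightarrow>\<^sub>0 nat)" where
  "evar j \<equiv> Poly_Mapping.single j (Suc 0)"

lemma mdeg_superset:
  assumes "finite A" "Poly_Mapping.keys \<alpha> \<subseteq> A"
  shows "mdeg \<alpha> = (\<Sum>i\<in>A. Poly_Mapping.lookup \<alpha> i)"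
  unfolding mdeg_def using assms by (intro sum.mono_neutral_left) (auto simp: in_keys_iff)

lemma mdeg_zero [simp]: "mdeg 0 = 0"
  by (simp add: mdeg_def)

lemma mdeg_evar [simp]: "mdeg (evar j) = 1"
  by (simp add: mdeg_def)

lemma mdeg_add: "mdeg (\<alpha> + \<beta>) = mdeg \<alpha> + mdeg \<beta>"
proof -
  let ?A = "Poly_Mapping.keys \<alpha> \<union> Poly_Mapping.keys \<beta>"
  have "Poly_Mapping.keys (\<alpha> + \<beta>) \<subseteq> ?A" by (rule keys_add)
  then show ?thesis
    using mdeg_superset[of ?A "\<alpha> + \<beta>"] mdeg_superset[of ?A \<alpha>] mdeg_superset[of ?A \<beta>]
    by (simp add: lookup_add sum.distrib)
qed

lemma mdeg_eq_0_iff [simp]: "mdeg \<alpha> = 0 \<longleftrightarrow> \<alpha> = 0"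
proof
  assume "mdeg \<alpha> = 0"
  then show "\<alpha> = 0" unfolding mdeg_def by (intro poly_mapping_eqI) (auto simp: in_keys_iff)
qed simp

lemma keys_add_nat:
  "Poly_Mapping.keys (\<alpha> + \<beta> :: 'a \<Rightarrow>\<^sub>0 nat) = Poly_Mapping.keys \<alpha> \<union> Poly_Mapping.keys \<beta>"
  by (auto simp: in_keys_iff lookup_add)

lemma evar_dvd:
  assumes "j \<in> Poly_Mapping.keys \<alpha>"
  obtains \<beta> where "\<alpha> = \<beta> + evar j"
proof
  show "\<alpha> = (\<alpha> - evar j) + evar j"
    using assms by (intro poly_mapping_eqI) (auto simp: lookup_add lookup_minus lookup_single in_keys_iff when_def)
qed

lemma mons_0 [simp]: "mons r 0 = {0}"
  by (auto simp: mons_def)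

lemma mons_0_left [simp]: "mons 0 (Suc d) = {}"
  by (auto simp: mons_def)

lemma mons_mono: "r \<le> s \<Longrightarrow> mons r d \<subseteq> mons s d"
  by (auto simp: mons_def)

lemma mons_add: "\<alpha> \<in> mons r d \<Longrightarrow> \<beta> \<in> mons r e \<Longrightarrow> \<alpha> + \<beta> \<in> mons r (d + e)"
  by (auto simp: mons_def keys_add_nat mdeg_add)

lemma mons_add_evar: "\<alpha> \<in> mons r d \<Longrightarrow> j < r \<Longrightarrow> \<alpha> + evar j \<in> mons r (Suc d)"
  by (auto simp: mons_def keys_add_nat mdeg_add)

lemma mons_add_cancel: "\<alpha> + \<beta> \<in> mons r (d + e) \<Longrightarrow> \<alpha> \<in> mons r d \<Longrightarrow> \<beta> \<in> mons r e"
  by (auto simp: mons_def keys_add_nat mdeg_add)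

lemma mons_add_evarD: "\<alpha> + evar j \<in> mons r (Suc d) \<Longrightarrow> \<alpha> \<in> mons r d \<and> j < r"
  by (auto simp: mons_def keys_add_nat mdeg_add)

lemma mons_Suc_exists:
  assumes "\<alpha> \<in> mons r (Suc d)"
  obtains j \<beta> where "j < r" "\<beta> \<in> mons r d" "\<alpha> = \<beta> + evar j"
proof -
  have "\<alpha> \<noteq> 0" using assms by (auto simp: mons_def)
  then obtain j where j: "j \<in> Poly_Mapping.keys \<alpha>" by (metis all_not_in_conv keys_eq_empty)
  then obtain \<beta> where "\<alpha> = \<beta> + evar j" by (rule evar_dvd)
  then show ?thesis using that assms mons_add_evarD by blast
qed

text \<open>Pascal's rule for sets: a monomial avoids the last variable or is divisible by
  it.\<close>

lemma mons_Suc_Suc: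
  "mons (Suc k) (Suc d) = mons k (Suc d) \<union> (\<lambda>\<alpha>. \<alpha> + evar k) ` mons (Suc k) d"
proof
  show "mons (Suc k) (Suc d) \<subseteq> mons k (Suc d) \<union> (\<lambda>\<alpha>. \<alpha> + evar k) ` mons (Suc k) d"
  proof
    fix \<alpha> assume a: "\<alpha> \<in> mons (Suc k) (Suc d)"
    show "\<alpha> \<in> mons k (Suc d) \<union> (\<lambda>\<alpha>. \<alpha> + evar k) ` mons (Suc k) d"
    proof (cases "k \<in> Poly_Mapping.keys \<alpha>")
      case True
      then obtain \<beta> where "\<alpha> = \<beta> + evar k" by (rule evar_dvd)
      then show ?thesis using a mons_add_evarD by blast
    next
      case False
      then show ?thesis using a by (auto simp: mons_def less_Suc_eq)
    qed
  qed
  show "mons k (Suc d) \<union> (\<lambda>\<alpha>. \<alpha> + evar k) ` mons (Suc k) d \<subseteq> mons (Suc k) (Suc d)"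
    using mons_mono[of k "Suc k"] mons_add_evar by fastforce
qed

lemma not_in_mons_add_evar: "\<alpha> + evar k \<notin> mons k d"
  by (auto simp: mons_def keys_add_nat)

lemma inj_add_evar: "inj_on (\<lambda>\<alpha>. \<alpha> + evar k) A"
  by (simp add: inj_on_def)

lemma finite_mons [simp]: "finite (mons r d)"
  and card_mons: "card (mons r d) = mcount r d"
proof -
  have "finite (mons r d) \<and> card (mons r d) = mcount r d"
  proof (induction r arbitrary: d)
    case 0
    show ?case by (cases d) auto
  next
    case (Suc r)
    note IH = Suc.IH
    show ?case
    proof (induction d)
      case (Suc d)
      have "card (mons (Suc r) (Suc d)) = card (mons r (Suc d)) + card ((\<lambda>\<alpha>. \<alpha> + evar r) ` mons (Suc r) d)"
        unfolding mons_Suc_Suc using Suc IH not_in_mons_add_evar by (intro card_Un_disjoint) auto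
      then show ?case
        using Suc IH by (simp add: mons_Suc_Suc card_image[OF inj_add_evar] mcount_Suc_Suc)
    qed simp
  qed
  then show "finite (mons r d)" "card (mons r d) = mcount r d" by auto
qed

text \<open>\<open>seg d n\<close> consists of the \<open>n\<close> smallest monomials of degree \<open>d\<close> in the lexicographic order in
  which variables of larger index are larger (and of at most one monomial if \<open>d = 0\<close>).\<close>

fun seg :: "nat \<Rightarrow> nat \<Rightarrow> (nat \<Rightarrow>\<^sub>0 nat) set" where
  "seg 0 n = (if n = 0 then {} else {0})"
| "seg (Suc d) n = mons (lead d n) (Suc d) \<union>
     (\<lambda>\<alpha>. \<alpha> + evar (lead d n)) ` seg d (n - mcount (lead d n) (Suc d))"

declare seg.simps(2) [simp del]

lemma seg_cascade_less:
  assumes "z < mcount (Suc k) d"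
  shows "seg (Suc d) (mcount k (Suc d) + z) = mons k (Suc d) \<union> (\<lambda>\<alpha>. \<alpha> + evar k) ` seg d z"
  using assms by (simp add: seg.simps(2) lead_eqI)

lemma seg_0 [simp]: "seg d 0 = {}"
proof (induction d)
  case (Suc d)
  then show ?case using seg_cascade_less[of 0 0 d] mcount_pos[of 0 d] by simp
qed simp

lemma seg_mcount: "seg d (mcount k d) = mons k d"
proof (cases d)
  case (Suc e)
  then show ?thesis using seg_cascade_less[of 0 k e] mcount_pos[of k e] by simp
qed simp

lemma seg_cascade:
  assumes "z \<le> mcount (Suc k) d"
  shows "seg (Suc d) (mcount k (Suc d) + z) = mons k (Suc d) \<union> (\<lambda>\<alpha>. \<alpha> + evar k) ` seg d z"
proof (cases "z = mcount (Suc k) d")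
  case True
  then show ?thesis
    using seg_mcount[of "Suc d" "Suc k"] seg_mcount[of d "Suc k"] by (simp add: mcount_Suc_Suc mons_Suc_Suc)
next
  case False
  then show ?thesis using seg_cascade_less assms by simp
qed

lemma seg_mono: "m \<le> n \<Longrightarrow> seg d m \<subseteq> seg d n"
proof (rule lift_Suc_mono_le[of "seg d"])
  show "seg d n \<subseteq> seg d (Suc n)" for n
  proof (induction d arbitrary: n)
    case (Suc d)
    obtain z where z: "n = mcount (lead d n) (Suc d) + z" "z < mcount (Suc (lead d n)) d"
      by (rule lead_decomp)
    show ?case
      using seg_cascade[of z "lead d n" d] seg_cascade[of "Suc z" "lead d n" d] z Suc.IH[of z] by auto
  qed simp
qed

lemma seg_subset_mons: "n \<le> mcount k d \<Longrightarrow> seg d n \<subseteq> mons k d"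
  using seg_mono seg_mcount by metis

text \<open>In positive degree a suitable \<open>k\<close> always exists by
  \<open>le_mcount\<close>; in degree 0 the hypothesis forces \<open>n\<close> to be at most 1,
  where \<open>seg\<close> saturates.\<close>

lemma card_seg:
  assumes "n \<le> mcount k d"
  shows "card (seg d n) = n"
  using assms
proof (induction d arbitrary: n k)
  case (Suc d)
  obtain z where z: "n = mcount (lead d n) (Suc d) + z" "z < mcount (Suc (lead d n)) d"
    by (rule lead_decomp)
  let ?k = "lead d n"
  have "seg d z \<subseteq> mons (Suc ?k) d" using z(2) by (intro seg_subset_mons) simp
  then have fin: "finite (seg d z)" by (rule finite_subset) simp
  have "seg (Suc d) n = mons ?k (Suc d) \<union> (\<lambda>\<alpha>. \<alpha> + evar ?k) ` seg d z"
    using seg_cascade[of z ?k d] z by simp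
  then have "card (seg (Suc d) n) = card (mons ?k (Suc d)) + card ((\<lambda>\<alpha>. \<alpha> + evar ?k) ` seg d z)"
    using not_in_mons_add_evar fin by (simp, intro card_Un_disjoint) auto
  then show ?case
    using Suc.IH[of z "Suc ?k"] z by (simp add: card_mons card_image[OF inj_add_evar])
qed auto

lemma mdeg_seg: "\<alpha> \<in> seg d n \<Longrightarrow> mdeg \<alpha> = d"
proof (induction d arbitrary: n \<alpha>)
  case 0
  then show ?case by (simp split: if_splits)
next
  case (Suc d)
  then show ?case by (auto simp: seg.simps(2) mons_def mdeg_add)
qed

text \<open>Division by a variable sends a segment into one of the size given by Macaulay's bound.
  This makes the lexicographic monomials closed under divisors, and it makes a monomial beyond the
  bound a socle element.\<close>

lemma seg_shadow:
  assumes "\<beta> + evar j \<in> seg (Suc d) n"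
  shows "\<beta> \<in> seg d (mac (Suc d) n)"
  using assms
proof (induction d arbitrary: n \<beta> j)
  case 0
  have n: "n \<noteq> 0" using 0 by (cases n) auto
  have "mdeg \<beta> = 0" using mdeg_seg[OF 0] by (simp add: mdeg_add)
  moreover have "mac (Suc 0) n \<noteq> 0"
    using mac_mono[of 1 n "Suc 0"] mac_1[of 0] n by simp
  ultimately show ?case by simp
next
  case (Suc e)
  obtain z where z: "n = mcount (lead (Suc e) n) (Suc (Suc e)) + z" "z < mcount (Suc (lead (Suc e) n)) (Suc e)"
    by (rule lead_decomp)
  define k where "k = lead (Suc e) n"
  have n: "n \<noteq> 0" using Suc.prems by (cases n) auto
  have le: "mac (Suc e) z \<le> mcount (Suc k) e"
    using mac_mono[of z "mcount (Suc k) (Suc e)" "Suc e"] mac_mcount[of e k] z by (simp add: k_def)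
  have "mac (Suc (Suc e)) n = mcount k (Suc e) + mac (Suc e) z"
    using mac_cascade[of z k "Suc e"] z n by (simp add: k_def)
  then have goal: "seg (Suc e) (mac (Suc (Suc e)) n) = mons k (Suc e) \<union> (\<lambda>\<alpha>. \<alpha> + evar k) ` seg e (mac (Suc e) z)"
    using seg_cascade[OF le] by simp
  have "seg (Suc (Suc e)) n = mons k (Suc (Suc e)) \<union> (\<lambda>\<alpha>. \<alpha> + evar k) ` seg (Suc e) z"
    using seg_cascade[of z k "Suc e"] z by (simp add: k_def)
  then consider "\<beta> + evar j \<in> mons k (Suc (Suc e))" | \<gamma> where "\<gamma> \<in> seg (Suc e) z" "\<beta> + evar j = \<gamma> + evar k"
    using Suc.prems by auto
  then show ?case
  proof cases
    case 1
    then show ?thesis using goal mons_add_evarD by blast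
  next
    case (2 \<gamma>)
    show ?thesis
    proof (cases "j = k")
      case True
      then have g: "\<beta> \<in> seg (Suc e) z" using 2 by simp
      then have "\<beta> \<in> mons (Suc k) (Suc e)"
        using seg_subset_mons[of z "Suc k" "Suc e"] z by (auto simp: k_def)
      \<comment> \<open>A quotient free of variable \<open>k\<close> lies in the full part of the
        target; one still divisible by \<open>k\<close> is divided once more, and the induction
        hypothesis places the result.\<close>
      then consider "\<beta> \<in> mons k (Suc e)" | \<delta> where "\<beta> = \<delta> + evar k"
        by (auto simp: mons_Suc_Suc)
      then show ?thesis
        using g goal Suc.IH by cases blast+
    next
      case False
      have "j \<in> Poly_Mapping.keys (\<gamma> + evar k)" unfolding 2(2)[symmetric] by (simp add: keys_add_nat)
      then have "j \<in> Poly_Mapping.keys \<gamma>" using False by (simp add: keys_add_nat)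
      then obtain \<delta> where d: "\<gamma> = \<delta> + evar j" by (rule evar_dvd)
      have "\<beta> + evar j = (\<delta> + evar k) + evar j" using 2(2) d by (simp add: ac_simps)
      then have "\<beta> = \<delta> + evar k" by simp
      then show ?thesis using goal Suc.IH[of \<delta> j z] 2(1) d by blast
    qed
  qed
qed

subsection \<open>Generic rank\<close>

context vector_space
begin

text \<open>The ambient function spaces are infinite-dimensional, so finiteness is a property of
  subsets.\<close>

definition fin_dim :: "'b set \<Rightarrow> bool" where
  "fin_dim V \<longleftrightarrow> (\<exists>W. finite W \<and> V \<subseteq> span W)"

lemma fin_dim_subset: "local.fin_dim W \<Longrightarrow> V \<subseteq> W \<Longrightarrow> local.fin_dim V"
  unfolding local.fin_dim_def by blast

lemma fin_dim_independent:
  assumes "local.fin_dim V" "B \<subseteq> V" "independent B"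
  shows "finite B" "card B \<le> dim V"
proof -
  obtain W where "finite W" "V \<subseteq> span W" using assms(1) local.fin_dim_def by blast
  then show "finite B" using independent_span_bound[of W B] assms by blast
  obtain C where C: "C \<subseteq> V" "independent C" "V \<subseteq> span C" "card C = dim V"
    by (rule basis_exists)
  have "finite C" using independent_span_bound[of W C] C \<open>finite W\<close> \<open>V \<subseteq> span W\<close> by blast
  then show "card B \<le> dim V"
    using independent_span_bound[of C B] C assms by (metis subset_trans)
qed

lemma fin_dim_mono:
  assumes "local.fin_dim W" "V \<subseteq> W"
  shows "dim V \<le> dim W"
proof -
  obtain B where "B \<subseteq> V" "independent B" "V \<subseteq> span B" "card B = dim V"
    by (rule basis_exists)
  then show ?thesis using local.fin_dim_independent[of W B] assms by auto
qed

lemma fin_dim_subspace_eq: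
  assumes "local.fin_dim W" "V \<subseteq> W" "subspace V" "dim W \<le> dim V"
  shows "V = W"
proof (rule ccontr)
  assume "V \<noteq> W"
  then obtain x where x: "x \<in> W" "x \<notin> V" using assms by blast
  obtain B where B: "B \<subseteq> V" "independent B" "V \<subseteq> span B" "card B = dim V"
    by (rule basis_exists)
  have "span B \<subseteq> V" using B assms(3) by (simp add: span_minimal)
  then have nx: "x \<notin> span B" using x by blast
  then have "independent (insert x B)" using B by (simp add: independent_insertI)
  moreover have "insert x B \<subseteq> W" using x B assms by auto
  ultimately have "card (insert x B) \<le> dim W" "finite (insert x B)"
    using local.fin_dim_independent[of W "insert x B"] assms(1) by simp_all
  moreover have "x \<notin> B" using nx span_base by blast
  ultimately show False using B assms by simp
qed

lemma dim_pos:
  assumes "local.fin_dim V" "x \<in> V" "x \<noteq> 0"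
  shows "1 \<le> dim V"
  using local.fin_dim_independent(2)[of V "{x}"] assms by simp

end

context vector_space_pair
begin

lemma fin_dim_image:
  assumes "Vector_Spaces.linear s1 s2 f" "vs1.fin_dim V"
  shows "vs2.fin_dim (f ` V)"
proof -
  obtain W where "finite W" "V \<subseteq> vs1.span W" using assms vs1.fin_dim_def by blast
  then have "f ` V \<subseteq> vs2.span (f ` W)"
    using linear_span_image[OF assms(1), of W] by blast
  then show ?thesis using \<open>finite W\<close> vs2.fin_dim_def by blast
qed

lemma rank_nullity:
  assumes lin: "Vector_Spaces.linear s1 s2 f" and sub: "vs1.subspace V" and fd: "vs1.fin_dim V"
  shows "vs1.dim V = vs1.dim {x \<in> V. f x = 0} + vs2.dim (f ` V)"
proof -
  let ?K = "{x \<in> V. f x = 0}"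
  obtain K where K: "K \<subseteq> ?K" "vs1.independent K" "?K \<subseteq> vs1.span K" "card K = vs1.dim ?K"
    by (rule vs1.basis_exists)
  obtain B where B: "K \<subseteq> B" "B \<subseteq> V" "vs1.independent B" "V \<subseteq> vs1.span B"
    using vs1.maximal_independent_subset_extend[of K V] K by blast
  have fin: "finite B" using vs1.fin_dim_independent fd B by blast
  let ?C = "B - K"
  have spB: "vs1.span B \<subseteq> V" using B sub by (simp add: vs1.span_minimal)
  have inj: "inj_on f (vs1.span ?C)"
  proof (subst linear_inj_on_iff_eq_0[OF lin vs1.subspace_span], intro ballI impI)
    fix x assume x: "x \<in> vs1.span ?C" "f x = 0"
    have "x \<in> V" using x spB vs1.span_mono[of ?C B] by blast
    then have "x \<in> vs1.span K" using x K by blast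
    moreover have "vs1.span K \<inter> vs1.span ?C = {0}"
    proof -
      have "y = 0" if y: "y \<in> vs1.span K" "y \<in> vs1.span ?C" for y
      proof -
        \<comment> \<open>Coordinates in \<open>K\<close> vanish because \<open>y\<close> lies in
          the span of \<open>?C\<close>, the others because it lies in the span of
          \<open>K\<close>.\<close>
        have "vs1.representation B y b = 0" if "b \<in> B" for b
        proof (cases "b \<in> K")
          case True
          have "vs1.representation B y = vs1.representation ?C y"
            using B y by (intro vs1.representation_extend) auto
          then show ?thesis using True vs1.representation_ne_zero[of ?C y b] by auto
        next
          case False
          have "vs1.representation B y = vs1.representation K y"
            using B y by (intro vs1.representation_extend) auto
          then show ?thesis using False vs1.representation_ne_zero[of K y b] by auto
        qed
        moreover have "y \<in> vs1.span B" using y vs1.span_mono[of ?C B] by blast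
        ultimately show ?thesis
          using vs1.sum_representation_eq[OF B(3) _ fin order_refl, of y] by simp
      qed
      then show ?thesis using vs1.span_zero by blast
    qed
    ultimately show "x = 0" using x by blast
  qed
  have ind: "vs2.independent (f ` ?C)"
    using linear_independent_injective_image[OF lin _ inj] vs1.independent_mono[OF B(3)] by blast
  have "f ` V \<subseteq> vs2.span (f ` ?C)"
  proof -
    have "f ` V \<subseteq> vs2.span (f ` B)" using B linear_span_image[OF lin, of B] by blast
    moreover have "f ` B \<subseteq> vs2.span (f ` ?C)"
    proof
      fix y assume "y \<in> f ` B"
      then obtain b where b: "b \<in> B" "y = f b" by blast
      show "y \<in> vs2.span (f ` ?C)"
      proof (cases "b \<in> K")
        case True
        then show ?thesis using K b vs2.span_zero by auto
      next
        case False
        then show ?thesis using b by (intro vs2.span_base) blast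
      qed
    qed
    then have "vs2.span (f ` B) \<subseteq> vs2.span (f ` ?C)"
      by (simp add: vs2.span_minimal)
    ultimately show ?thesis by blast
  qed
  then have "card (f ` ?C) = vs2.dim (f ` V)"
    using ind B by (intro vs2.basis_card_eq_dim) auto
  moreover have "card (f ` ?C) = card ?C"
    using inj_on_subset[OF inj vs1.span_superset] by (rule card_image)
  moreover have "card B = vs1.dim V" using B by (intro vs1.basis_card_eq_dim)
  moreover have "card ?C = card B - card K" "card K \<le> card B"
    using B fin by (auto intro: card_Diff_subset card_mono finite_subset)
  ultimately show ?thesis using K by simp
qed

end

section \<open>Function spaces and independent families\<close>

definition fscale :: "'k::field \<Rightarrow> ('a \<Rightarrow> 'k) \<Rightarrow> 'a \<Rightarrow> 'k" where
  "fscale c f = (\<lambda>x. c * f x)"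

global_interpretation fn: vector_space "fscale :: 'k::field \<Rightarrow> ('a \<Rightarrow> 'k) \<Rightarrow> 'a \<Rightarrow> 'k"
  by unfold_locales (auto simp: fscale_def algebra_simps)

global_interpretation fn2: vector_space_pair
  "fscale :: 'k::field \<Rightarrow> ('a \<Rightarrow> 'k) \<Rightarrow> 'a \<Rightarrow> 'k" "fscale :: 'k \<Rightarrow> ('b \<Rightarrow> 'k) \<Rightarrow> 'b \<Rightarrow> 'k"
  by unfold_locales

abbreviation flinear :: "(('a \<Rightarrow> 'k::field) \<Rightarrow> 'b \<Rightarrow> 'k) \<Rightarrow> bool" where
  "flinear \<equiv> Vector_Spaces.linear fscale fscale"

lemma flinearI:
  fixes T :: "('a \<Rightarrow> 'k::field) \<Rightarrow> 'b \<Rightarrow> 'k"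
  assumes "\<And>f g x. T (\<lambda>y. f y + g y) x = T f x + T g x"
    and "\<And>c f x. T (\<lambda>y. c * f y) x = c * T f x"
  shows "flinear T"
  unfolding Vector_Spaces.linear_iff
  by (auto simp: fscale_def plus_fun_def assms fn.vector_space_axioms)

lemma sum_fun_apply: "(\<Sum>i\<in>A. f i) x = (\<Sum>i\<in>A. f i x)"
  for f :: "'i \<Rightarrow> 'a \<Rightarrow> 'k::field"
  by (induction A rule: infinite_finite_induct) auto

text \<open>Indexed families instead of sets: the members will depend on a parameter, and may
  coincide for special values of it.\<close>

definition indep_fam :: "nat \<Rightarrow> (nat \<Rightarrow> 'a \<Rightarrow> 'k::field) \<Rightarrow> bool" where
  "indep_fam n v \<longleftrightarrow> (\<forall>c. (\<forall>x. (\<Sum>i<n. c i * v i x) = 0) \<longrightarrow> (\<forall>i<n. c i = 0))"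

lemma indep_fam_le_dim:
  assumes ind: "indep_fam n v" and V: "\<And>i. i < n \<Longrightarrow> v i \<in> V" and fd: "fn.fin_dim V"
  shows "n \<le> fn.dim V"
proof -
  have inj: "inj_on v {..<n}"
  proof (rule inj_onI)
    fix i j assume ij: "i \<in> {..<n}" "j \<in> {..<n}" "v i = v j"
    show "i = j"
    proof (rule ccontr)
      assume ne: "i \<noteq> j"
      define c where "c l = (if l = i then 1 else 0) - (if l = j then 1 else (0::'b))" for l
      have "(\<Sum>l<n. c l * v l x) = 0" for x
        using ij by (simp add: c_def left_diff_distrib sum_subtractf if_distrib[of "\<lambda>a. a * _"] cong: if_cong)
      then have "c i = 0" using ind ij unfolding indep_fam_def by blast
      then show False using ne by (simp add: c_def)
    qed
  qed
  have "fn.independent (v ` {..<n})"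
  proof (rule fn.independent_if_scalars_zero)
    fix f x assume s: "(\<Sum>x\<in>v ` {..<n}. fscale (f x) x) = 0" and x: "x \<in> v ` {..<n}"
    have "(\<Sum>i<n. fscale (f (v i)) (v i)) = 0"
      using s by (simp add: sum.reindex[OF inj])
    from fun_cong[OF this] have "(\<Sum>i<n. f (v i) * v i y) = 0" for y
      by (simp add: sum_fun_apply fscale_def)
    then have "\<forall>i<n. f (v i) = 0"
      using ind[unfolded indep_fam_def, rule_format, of "\<lambda>i. f (v i)"] by simp
    then show "f x = 0" using x by auto
  qed simp
  then have "card (v ` {..<n}) \<le> fn.dim V"
    by (rule fn.fin_dim_independent(2)[OF fd, rotated]) (use V in auto)
  then show ?thesis by (simp add: card_image[OF inj])
qed

lemma indep_fam_exists:
  fixes V :: "('a \<Rightarrow> 'k::field) set"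
  assumes "n \<le> fn.dim V" "fn.fin_dim V"
  obtains v where "indep_fam n v" "\<And>i. i < n \<Longrightarrow> v i \<in> V"
proof -
  obtain B where B: "B \<subseteq> V" "fn.independent B" "V \<subseteq> fn.span B" "card B = fn.dim V"
    by (rule fn.basis_exists)
  have fin: "finite B" using fn.fin_dim_independent assms B by blast
  obtain v where v: "bij_betw v {0..<card B} B" using ex_bij_betw_nat_finite[OF fin] by blast
  have n: "n \<le> card B" using assms B by simp
  have "indep_fam n v"
    unfolding indep_fam_def
  proof (intro allI impI)
    fix c :: "nat \<Rightarrow> 'k" and i assume c: "\<forall>x. (\<Sum>i<n. c i * v i x) = 0" and i: "i < n"
    define u where "u b = (let j = inv_into {0..<card B} v b in if j < n then c j else 0)" for b
    have inv: "inv_into {0..<card B} v (v j) = j" if "j < card B" for j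
      using that v by (simp add: bij_betw_inv_into_left)
    have "(\<Sum>b\<in>B. fscale (u b) b) = (\<Sum>j\<in>{0..<card B}. fscale (u (v j)) (v j))"
      using sum.reindex_bij_betw[OF v, of "\<lambda>b. fscale (u b) b"] by simp
    also have "\<dots> = (\<Sum>j\<in>{0..<card B}. if j < n then fscale (c j) (v j) else 0)"
      by (intro sum.cong) (auto simp: u_def inv Let_def)
    also have "\<dots> = (\<Sum>j\<in>{0..<card B} \<inter> {j. j < n}. fscale (c j) (v j))"
      by (simp add: sum.If_cases)
    also have "{0..<card B} \<inter> {j. j < n} = {..<n}" using n by auto
    also have "(\<Sum>j<n. fscale (c j) (v j)) = 0"
      using c by (intro ext) (simp add: sum_fun_apply fscale_def)
    finally have "u (v i) = 0"
      using fn.independentD[OF B(2) fin order_refl] i n v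
      by (metis (no_types, lifting) atLeastLessThan_iff bij_betwE le0 order_less_le_trans)
    then show "c i = 0" using i n by (simp add: u_def inv)
  qed
  moreover have "v i \<in> V" if "i < n" for i
    using that n v B by (auto simp: bij_betw_def)
  ultimately show ?thesis using that by blast
qed

section \<open>Polynomial functions and generic properties\<close>

text \<open>Polynomials are kept as functions on all points; \<open>X\<close> records which
  coordinates may occur, so that a form, which has coefficients only at monomials of its degree, can
  replace a point.\<close>

inductive_set polyfun :: "'i set \<Rightarrow> (('i \<Rightarrow> 'k::comm_ring_1) \<Rightarrow> 'k) set" for X where
  polyfun_const: "(\<lambda>p. c) \<in> polyfun X"
| polyfun_coord: "i \<in> X \<Longrightarrow> (\<lambda>p. p i) \<in> polyfun X"
| polyfun_add: "f \<in> polyfun X \<Longrightarrow> g \<in> polyfun X \<Longrightarrow> (\<lambda>p. f p + g p) \<in> polyfun X"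
| polyfun_mult: "f \<in> polyfun X \<Longrightarrow> g \<in> polyfun X \<Longrightarrow> (\<lambda>p. f p * g p) \<in> polyfun X"

lemma polyfun_diff:
  assumes "f \<in> polyfun X" "g \<in> polyfun X"
  shows "(\<lambda>p. f p - g p) \<in> polyfun X"
  using polyfun_add[OF assms(1) polyfun_mult[OF polyfun_const[of "-1"] assms(2)]] by simp

lemma polyfun_sum:
  "(\<And>j. j \<in> A \<Longrightarrow> f j \<in> polyfun X) \<Longrightarrow> (\<lambda>p. \<Sum>j\<in>A. f j p) \<in> polyfun X"
  by (induction A rule: infinite_finite_induct) (auto intro: polyfun_const polyfun_add)

lemma polyfun_cong_on:
  assumes "f \<in> polyfun X" "\<And>i. i \<in> X \<Longrightarrow> p i = q i"
  shows "f p = f q"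
  using assms by induction auto

lemma polyfun_line:
  assumes "f \<in> polyfun X"
  shows "\<exists>q. \<forall>s. f (\<lambda>i. p0 i + s * (p1 i - p0 i)) = poly q s"
  using assms
proof induction
  case (polyfun_const c)
  have "\<forall>s. c = poly [:c:] s" by simp
  then show ?case by blast
next
  case (polyfun_coord i)
  have "\<forall>s. p0 i + s * (p1 i - p0 i) = poly [:p0 i, p1 i - p0 i:] s" by simp
  then show ?case by blast
next
  case (polyfun_add f g)
  then show ?case by (metis poly_add)
next
  case (polyfun_mult f g)
  then show ?case by (metis poly_mult)
qed

definition gen :: "'i set \<Rightarrow> (('i \<Rightarrow> 'k::field) \<Rightarrow> bool) \<Rightarrow> bool" where
  "gen X P \<longleftrightarrow> (\<exists>f\<in>polyfun X. (\<exists>p. f p \<noteq> 0) \<and> (\<forall>p. f p \<noteq> 0 \<longrightarrow> P p))"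

lemma gen_ex: "gen X P \<Longrightarrow> \<exists>p. P p"
  unfolding gen_def by blast

lemma gen_mono: "gen X P \<Longrightarrow> (\<And>p. P p \<Longrightarrow> Q p) \<Longrightarrow> gen X Q"
  unfolding gen_def by blast

lemma gen_True: "(\<And>p. P p) \<Longrightarrow> gen X P"
  unfolding gen_def by (rule bexI[of _ "\<lambda>p. 1"]) (auto intro: polyfun_const)

text \<open>On the line through two points where \<open>f\<close> and \<open>g\<close> do not vanish, both are nonzero
  univariate polynomials, and these have a common nonzero over an infinite field.\<close>

lemma gen_conj:
  fixes P Q :: "('i \<Rightarrow> 'k::field_char_0) \<Rightarrow> bool"
  assumes "gen X P" "gen X Q"
  shows "gen X (\<lambda>p. P p \<and> Q p)"
proof -
  obtain f p0 where f: "f \<in> polyfun X" "f p0 \<noteq> 0" "\<And>p. f p \<noteq> 0 \<Longrightarrow> P p"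
    using assms(1) unfolding gen_def by blast
  obtain g p1 where g: "g \<in> polyfun X" "g p1 \<noteq> 0" "\<And>p. g p \<noteq> 0 \<Longrightarrow> Q p"
    using assms(2) unfolding gen_def by blast
  let ?l = "\<lambda>s i. p0 i + s * (p1 i - p0 i)"
  obtain q where q: "\<And>s. f (?l s) = poly q s" using polyfun_line[OF f(1)] by metis
  obtain q' where q': "\<And>s. g (?l s) = poly q' s" using polyfun_line[OF g(1)] by metis
  have "q \<noteq> 0" using q[of 0] f(2) by auto
  moreover have "q' \<noteq> 0" using q'[of 1] g(2) by auto
  ultimately have "finite {s. poly (q * q') s = 0}" by (intro poly_roots_finite) simp
  then obtain s where "poly (q * q') s \<noteq> 0"
    using ex_new_if_finite[OF infinite_UNIV_char_0] by blast
  then have "f (?l s) * g (?l s) \<noteq> 0" using q q' by simp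
  moreover have "(\<lambda>p. f p * g p) \<in> polyfun X" using f g by (simp add: polyfun_mult)
  ultimately show ?thesis unfolding gen_def using f(3) g(3)
    by (intro bexI[of _ "\<lambda>p. f p * g p"]) auto
qed

lemma gen_ball:
  fixes P :: "nat \<Rightarrow> ('i \<Rightarrow> 'k::field_char_0) \<Rightarrow> bool"
  assumes "\<And>i. i < n \<Longrightarrow> gen X (P i)"
  shows "gen X (\<lambda>p. \<forall>i<n. P i p)"
  using assms
proof (induction n)
  case (Suc n)
  have "gen X (\<lambda>p. (\<forall>i<n. P i p) \<and> P n p)" using Suc by (intro gen_conj) auto
  then show ?case by (rule gen_mono) (auto simp: less_Suc_eq)
qed (simp add: gen_True)

text \<open>Gaussian elimination carried out without divisions, with entries polynomial in the parameter.\<close>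

lemma indep_fam_open:
  fixes v :: "('i \<Rightarrow> 'k::field) \<Rightarrow> nat \<Rightarrow> 'a \<Rightarrow> 'k"
  assumes "\<And>i x. i < n \<Longrightarrow> (\<lambda>p. v p i x) \<in> polyfun X" "indep_fam n (v p0)"
  shows "\<exists>f\<in>polyfun X. f p0 \<noteq> 0 \<and> (\<forall>p. f p \<noteq> 0 \<longrightarrow> indep_fam n (v p))"
  using assms
proof (induction n arbitrary: v)
  case 0
  show ?case by (rule bexI[of _ "\<lambda>p. 1"]) (auto simp: indep_fam_def intro: polyfun_const)
next
  case (Suc n)
  have "\<exists>x. v p0 n x \<noteq> 0"
  proof (rule ccontr)
    assume "\<not> ?thesis"
    then have "\<forall>x. (\<Sum>i<Suc n. (if i = n then 1 else 0) * v p0 i x) = 0" by simp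
    then show False
      using Suc.prems(2)[unfolded indep_fam_def, rule_format, of "\<lambda>i. if i = n then 1 else 0" n] by simp
  qed
  then obtain x where x: "v p0 n x \<noteq> 0" by blast
  define w where "w p i y = v p n x * v p i y - v p i x * v p n y" for p i y
  have wsum: "(\<Sum>i<n. c i * w p i y) = v p n x * (\<Sum>i<n. c i * v p i y) - (\<Sum>i<n. c i * v p i x) * v p n y" for c p y
    by (simp add: w_def right_diff_distrib sum_subtractf sum_distrib_left sum_distrib_right mult_ac)
  have "indep_fam n (w p0)"
    unfolding indep_fam_def
  proof (intro allI impI)
    fix c i assume c: "\<forall>y. (\<Sum>i<n. c i * w p0 i y) = 0" and i: "i < n"
    \<comment> \<open>A relation among the \<open>w\<close> becomes one among the \<open>v\<close>
      once the multiples of the pivot vector \<open>v p0 n\<close> are collected.\<close>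
    define e where "e j = (if j = n then - (\<Sum>i<n. c i * v p0 i x) else c j * v p0 n x)" for j
    have "\<forall>y. (\<Sum>j<Suc n. e j * v p0 j y) = 0"
      using c unfolding wsum by (simp add: e_def sum_distrib_left mult_ac)
    then have "\<forall>j<Suc n. e j = 0" using Suc.prems(2) unfolding indep_fam_def by blast
    then have "e i = 0" using i by simp
    then show "c i = 0" using i x by (simp add: e_def)
  qed
  moreover have "(\<lambda>p. w p i y) \<in> polyfun X" if "i < n" for i y
    unfolding w_def using that Suc.prems(1) by (intro polyfun_diff polyfun_mult) auto
  ultimately obtain f where f: "f \<in> polyfun X" "f p0 \<noteq> 0" "\<And>p. f p \<noteq> 0 \<Longrightarrow> indep_fam n (w p)"
    using Suc.IH by blast
  have "indep_fam (Suc n) (v p)" if nz: "v p n x * f p \<noteq> 0" for p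
    unfolding indep_fam_def
  proof (intro allI impI)
    fix c i assume c: "\<forall>y. (\<Sum>i<Suc n. c i * v p i y) = 0" and i: "i < Suc n"
    have s: "(\<Sum>i<n. c i * v p i y) = - (c n * v p n y)" for y
      using c by (simp add: eq_neg_iff_add_eq_0)
    have "(\<Sum>i<n. c i * w p i y) = 0" for y unfolding wsum s by simp
    then have c0: "\<forall>i<n. c i = 0" using f(3)[of p] nz unfolding indep_fam_def by simp
    then have "c n = 0" using s[of x] nz by simp
    then show "c i = 0" using c0 i less_Suc_eq by auto
  qed
  moreover have "(\<lambda>p. v p n x * f p) \<in> polyfun X" using Suc.prems(1) f(1) by (intro polyfun_mult) auto
  ultimately show ?case using x f(2) by (intro bexI[of _ "\<lambda>p. v p n x * f p"]) auto
qed

text \<open>Lower semicontinuity of rank: preimages of \<open>n\<close> independent vectors at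
  \<open>p0\<close> stay fixed while \<open>p\<close> varies, and independence of their images is an
  open condition.\<close>

lemma gen_dim_image:
  fixes T :: "('i \<Rightarrow> 'k::field) \<Rightarrow> ('a \<Rightarrow> 'k) \<Rightarrow> 'b \<Rightarrow> 'k"
  assumes poly: "\<And>\<phi> x. \<phi> \<in> V \<Longrightarrow> (\<lambda>p. T p \<phi> x) \<in> polyfun X"
    and fd: "\<And>p. fn.fin_dim (T p ` V)"
    and n: "n \<le> fn.dim (T p0 ` V)"
  shows "gen X (\<lambda>p. n \<le> fn.dim (T p ` V))"
proof -
  obtain v where v: "indep_fam n v" "\<And>i. i < n \<Longrightarrow> v i \<in> T p0 ` V"
    using indep_fam_exists[OF n fd] by blast
  then have "\<forall>i. \<exists>\<phi>. i < n \<longrightarrow> \<phi> \<in> V \<and> v i = T p0 \<phi>" by blast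
  from choice[OF this] obtain w where w: "\<And>i. i < n \<Longrightarrow> w i \<in> V \<and> v i = T p0 (w i)" by blast
  have "(\<Sum>i<n. c i * v i x) = (\<Sum>i<n. c i * T p0 (w i) x)" for c x
    using w by (intro sum.cong) auto
  then have "indep_fam n (\<lambda>i. T p0 (w i))" using v(1) unfolding indep_fam_def by simp
  then obtain f where f: "f \<in> polyfun X" "f p0 \<noteq> 0" "\<And>p. f p \<noteq> 0 \<Longrightarrow> indep_fam n (\<lambda>i. T p (w i))"
    using indep_fam_open[of n "\<lambda>p i. T p (w i)" X p0] poly w by blast
  have "n \<le> fn.dim (T p ` V)" if "f p \<noteq> 0" for p
    using indep_fam_le_dim[OF f(3)[OF that] _ fd] w by blast
  then show ?thesis unfolding gen_def using f by blast
qed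

subsection \<open>Green's theorem\<close>

definition fsupp :: "'a set \<Rightarrow> ('a \<Rightarrow> 'k::field) set" where
  "fsupp S = {\<phi>. \<forall>x. x \<notin> S \<longrightarrow> \<phi> x = 0}"

lemma
  assumes "finite S"
  shows fin_dim_fsupp: "fn.fin_dim (fsupp S :: ('a \<Rightarrow> 'k::field) set)"
    and dim_fsupp_le: "fn.dim (fsupp S :: ('a \<Rightarrow> 'k) set) \<le> card S"
proof -
  define \<delta> :: "'a \<Rightarrow> 'a \<Rightarrow> 'k" where "\<delta> s = (\<lambda>x. if x = s then 1 else 0)" for s
  have "\<phi> \<in> fn.span (\<delta> ` S)" if "\<phi> \<in> fsupp S" for \<phi>
  proof -
    have "\<phi> x = (\<Sum>s\<in>S. fscale (\<phi> s) (\<delta> s)) x" for x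
    proof -
      have "(\<Sum>s\<in>S. \<phi> s * \<delta> s x) = (\<Sum>s\<in>S. if x = s then \<phi> s else 0)"
        by (intro sum.cong) (auto simp: \<delta>_def)
      then show ?thesis using that assms by (auto simp: fsupp_def sum_fun_apply fscale_def)
    qed
    then have "\<phi> = (\<Sum>s\<in>S. fscale (\<phi> s) (\<delta> s))" by (rule ext)
    also have "\<dots> \<in> fn.span (\<delta> ` S)"
      by (intro fn.span_sum fn.span_scale fn.span_base) auto
    finally show ?thesis .
  qed
  then have sub: "fsupp S \<subseteq> fn.span (\<delta> ` S)" by blast
  then show "fn.fin_dim (fsupp S :: ('a \<Rightarrow> 'k) set)" using assms fn.fin_dim_def by blast
  have "fn.dim (fsupp S :: ('a \<Rightarrow> 'k) set) \<le> card (\<delta> ` S)"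
    using sub assms by (intro fn.dim_le_card) auto
  also have "\<dots> \<le> card S" using assms by (rule card_image_le)
  finally show "fn.dim (fsupp S :: ('a \<Rightarrow> 'k) set) \<le> card S" .
qed

text \<open>The transpose of multiplication by the linear form with coefficients \<open>a\<close>;
  see \<open>act_lform\<close>.\<close>

definition lact :: "nat \<Rightarrow> (nat \<Rightarrow> 'k::field) \<Rightarrow> ((nat \<Rightarrow>\<^sub>0 nat) \<Rightarrow> 'k) \<Rightarrow> (nat \<Rightarrow>\<^sub>0 nat) \<Rightarrow> 'k" where
  "lact r a \<phi> = (\<lambda>m. \<Sum>j<r. a j * \<phi> (m + evar j))"

lemma flinear_lact: "flinear (lact r a)"
  by (rule flinearI) (simp_all add: lact_def algebra_simps sum.distrib sum_distrib_left)

lemma lact_fsupp: "\<phi> \<in> fsupp (mons r (Suc e)) \<Longrightarrow> lact r a \<phi> \<in> fsupp (mons r e)"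
  unfolding fsupp_def lact_def using mons_add_evarD by (fastforce intro!: sum.neutral)

lemma lact_commute: "lact r a (lact r b \<phi>) = lact r b (lact r a \<phi>)"
proof
  fix m
  have "lact r a (lact r b \<phi>) m = (\<Sum>i<r. \<Sum>j<r. a i * (b j * \<phi> (m + evar i + evar j)))"
    by (simp add: lact_def sum_distrib_left)
  also have "\<dots> = (\<Sum>j<r. \<Sum>i<r. a i * (b j * \<phi> (m + evar i + evar j)))"
    by (rule sum.swap)
  also have "\<dots> = lact r b (lact r a \<phi>) m"
    by (simp add: lact_def sum_distrib_left ac_simps)
  finally show "lact r a (lact r b \<phi>) m = lact r b (lact r a \<phi>) m" .
qed

lemma lact_eq_0_imp:
  assumes "\<phi> \<in> fsupp (mons r (Suc e))" "\<And>a. lact r a \<phi> = 0"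
  shows "\<phi> = 0"
proof
  fix m show "\<phi> m = 0 m"
  proof (cases "m \<in> mons r (Suc e)")
    case True
    then obtain j \<beta> where j: "j < r" "\<beta> \<in> mons r e" "m = \<beta> + evar j" by (rule mons_Suc_exists)
    have "lact r (\<lambda>i. if i = j then 1 else 0) \<phi> \<beta> = (\<Sum>i<r. if i = j then \<phi> (\<beta> + evar i) else 0)"
      unfolding lact_def by (intro sum.cong) auto
    then show ?thesis using assms(2)[of "\<lambda>i. if i = j then 1 else 0"] j by simp
  qed (use assms in \<open>auto simp: fsupp_def\<close>)
qed

text \<open>Green's hyperplane restriction theorem in dual form. For general linear forms \<open>g\<close> and \<open>h\<close>,
  the kernel \<open>K\<close> of \<open>h\<close> on \<open>V\<close> satisfies \<open>g K \<subseteq> ker h \<inter> g V\<close>; the left side is bounded below by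
  induction on the dimension, the right side above by induction on the degree.\<close>

theorem green:
  fixes V :: "((nat \<Rightarrow>\<^sub>0 nat) \<Rightarrow> 'k::field_char_0) set"
  assumes "fn.subspace V" "V \<subseteq> fsupp (mons r d)"
  shows "\<exists>a. mac d (fn.dim V) \<le> fn.dim (lact r a ` V)"
  using assms
proof (induction d arbitrary: V)
  case 0
  then show ?case by simp
next
  case (Suc e)
  note IH_deg = Suc.IH
  show ?case using Suc.prems
  proof (induction "fn.dim V" arbitrary: V rule: less_induct)
    case less
    note IH_dim = less.hyps and sub = less.prems(1) and supp = less.prems(2)
    define c where "c = fn.dim V"
    have fdV: "fn.fin_dim V" using supp fin_dim_fsupp[OF finite_mons] fn.fin_dim_subset by blast
    \<comment> \<open>The largest rank, which is also the rank of a general linear form.\<close>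
    define \<rho> where "\<rho> = Max (range (\<lambda>a. fn.dim (lact r a ` V)))"
    have fdI: "fn.fin_dim (lact r a ` V)" for a
      using fn2.fin_dim_image[OF flinear_lact fdV] .
    have rn: "c = fn.dim {x \<in> V. lact r a x = 0} + fn.dim (lact r a ` V)" for a
      unfolding c_def by (rule fn2.rank_nullity[OF flinear_lact sub fdV])
    have bd: "finite (range (\<lambda>a. fn.dim (lact r a ` V)))"
    proof (rule finite_subset)
      show "range (\<lambda>a. fn.dim (lact r a ` V)) \<subseteq> {..c}"
      proof safe
        fix a show "fn.dim (lact r a ` V) \<le> c" using rn[of a] by simp
      qed
    qed simp
    have max: "fn.dim (lact r a ` V) \<le> \<rho>" for a
      unfolding \<rho>_def using bd by (intro Max_ge) auto
    have "\<rho> \<in> range (\<lambda>a. fn.dim (lact r a ` V))"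
      unfolding \<rho>_def using bd by (intro Max_in) auto
    then obtain g0 where g0: "fn.dim (lact r g0 ` V) = \<rho>" by auto
    have \<rho>c: "\<rho> \<le> c" using rn[of g0] g0 by simp
    show ?case
    proof (cases "\<exists>x\<in>V. x \<noteq> 0")
      case False
      then have "V \<subseteq> fn.span {}" by auto
      then have "fn.dim V = 0" using fn.dim_le_card[of V "{}"] by simp
      then show ?thesis by simp
    next
      case True
      \<comment> \<open>Positivity of \<open>\<rho>\<close> makes the kernel of a form of maximal
        rank smaller than \<open>V\<close>, as the induction on the dimension requires.\<close>
      then obtain x a where "x \<in> V" "lact r a x \<noteq> 0" using lact_eq_0_imp supp by blast
      then have "1 \<le> fn.dim (lact r a ` V)" using fn.dim_pos[OF fdI] by blast
      then have \<rho>1: "1 \<le> \<rho>" using max order_trans by blast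
      \<comment> \<open>A point \<open>p\<close> encodes both linear forms, so that one generic
        choice serves all four conditions.\<close>
      define G where "G p = (\<lambda>j. p (True, j))" for p :: "bool \<times> nat \<Rightarrow> 'k"
      define H where "H p = (\<lambda>j. p (False, j))" for p :: "bool \<times> nat \<Rightarrow> 'k"
      \<comment> \<open>The pair of contractions by \<open>H p\<close> and \<open>G p\<close>. Its
        rank is the rank of \<open>H p\<close> on \<open>V\<close> plus the rank of
        \<open>G p\<close> on the kernel of \<open>H p\<close>, but it is taken on the fixed space
        \<open>V\<close>, where semicontinuity applies.\<close>
      define T where "T p \<phi> = (\<lambda>(b, m). if b then lact r (H p) \<phi> m else lact r (G p) \<phi> m)"
        for p :: "bool \<times> nat \<Rightarrow> 'k" and \<phi> :: "(nat \<Rightarrow>\<^sub>0 nat) \<Rightarrow> 'k"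
      have pG: "(\<lambda>p. lact r (G p) \<phi> m) \<in> polyfun UNIV" for \<phi> m
        unfolding lact_def G_def by (intro polyfun_sum polyfun_mult polyfun_coord polyfun_const) auto
      have pH: "(\<lambda>p. lact r (H p) \<phi> m) \<in> polyfun UNIV" for \<phi> m
        unfolding lact_def H_def by (intro polyfun_sum polyfun_mult polyfun_coord polyfun_const) auto
      have pHG: "(\<lambda>p. lact r (H p) (lact r (G p) \<phi>) m) \<in> polyfun UNIV" for \<phi> m
        unfolding lact_def H_def G_def by (intro polyfun_sum polyfun_mult polyfun_coord polyfun_const) auto
      have pT: "(\<lambda>p. T p \<phi> x) \<in> polyfun UNIV" for \<phi> x
        using pG pH by (cases x, cases "fst x") (simp_all add: T_def)
      have linT: "flinear (T p)" for p
        by (rule flinearI) (auto simp: T_def lact_def algebra_simps sum.distrib sum_distrib_left)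
      have subI: "fn.subspace (lact r a ` V)" for a
        by (rule fn2.linear_subspace_image[OF flinear_lact sub])
      have suppI: "lact r a ` V \<subseteq> fsupp (mons r e)" for a
        using supp lact_fsupp by blast

      obtain h0 where h0: "mac e \<rho> \<le> fn.dim (lact r h0 ` lact r g0 ` V)"
        using IH_deg[OF subI suppI, of g0] g0 by auto
      have gen1: "gen UNIV (\<lambda>p. \<rho> \<le> fn.dim (lact r (G p) ` V))"
        using gen_dim_image[of V "\<lambda>p. lact r (G p)" UNIV \<rho> "\<lambda>(b, j). g0 j"] pG fdI g0
        by (simp add: G_def)
      have gen2: "gen UNIV (\<lambda>p. \<rho> \<le> fn.dim (lact r (H p) ` V))"
        using gen_dim_image[of V "\<lambda>p. lact r (H p)" UNIV \<rho> "\<lambda>(b, j). g0 j"] pH fdI g0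
        by (simp add: H_def)
      have gen3: "gen UNIV (\<lambda>p. mac e \<rho> \<le> fn.dim ((\<lambda>\<phi>. lact r (H p) (lact r (G p) \<phi>)) ` V))"
      proof (rule gen_dim_image[where ?p0.0 = "\<lambda>(b, j). if b then g0 j else h0 j"])
        show "fn.fin_dim ((\<lambda>\<phi>. lact r (H p) (lact r (G p) \<phi>)) ` V)" for p
          using fn2.fin_dim_image[OF flinear_lact fdI, of r "H p" "G p"] by (simp add: image_image)
      qed (use pHG h0 in \<open>simp_all add: G_def H_def image_image\<close>)

      let ?K = "\<lambda>a. {x \<in> V. lact r a x = 0}"
      have subK: "fn.subspace (?K a)" for a
        using sub fn2.linear_subspace_kernel[OF flinear_lact, of r a] fn.subspace_inter[of V "{x. lact r a x = 0}"]
        by (simp add: Int_def)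
      have fdK: "fn.fin_dim (?K a)" for a
        using fdV by (rule fn.fin_dim_subset) auto
      have kerT: "{x \<in> V. T p x = 0} = {x \<in> ?K (H p). lact r (G p) x = 0}" for p
        by (auto simp: T_def fun_eq_iff split: if_splits)
      have rnT: "c = fn.dim {x \<in> V. T p x = 0} + fn.dim (T p ` V)" for p
        unfolding c_def by (rule fn2.rank_nullity[OF linT sub fdV])
      have rnK: "fn.dim (?K a) = fn.dim {x \<in> ?K a. lact r b x = 0} + fn.dim (lact r b ` ?K a)" for a b
        by (rule fn2.rank_nullity[OF flinear_lact subK fdK])
      have dimK: "fn.dim (?K g0) = c - \<rho>" using rn[of g0] g0 by simp
      have "\<exists>a. mac (Suc e) (fn.dim (?K g0)) \<le> fn.dim (lact r a ` ?K g0)"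
        using supp subK dimK \<rho>1 \<rho>c by (intro IH_dim) (auto simp: c_def)
      then obtain g1 where g1: "mac (Suc e) (c - \<rho>) \<le> fn.dim (lact r g1 ` ?K g0)"
        unfolding dimK by blast
      \<comment> \<open>At the special point \<open>H\<close> is \<open>g0\<close>, of rank
        \<open>\<rho>\<close>, and \<open>G\<close> is the form \<open>g1\<close> that the induction
        on the dimension supplies for the kernel of \<open>g0\<close>.\<close>
      have gen4: "gen UNIV (\<lambda>p. \<rho> + mac (Suc e) (c - \<rho>) \<le> fn.dim (T p ` V))"
      proof (rule gen_dim_image)
        let ?p = "\<lambda>(b, j). if b then g1 j else g0 j"
        have GH: "G ?p = g1" "H ?p = g0" by (auto simp: G_def H_def)
        show "\<rho> + mac (Suc e) (c - \<rho>) \<le> fn.dim (T ?p ` V)"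
          using rnT[of ?p] rnK[of g0 g1] kerT[of ?p] dimK g1 \<rho>c unfolding GH by simp
      qed (use pT fn2.fin_dim_image[OF linT fdV] in auto)

      obtain p where p: "\<rho> \<le> fn.dim (lact r (G p) ` V)" "\<rho> \<le> fn.dim (lact r (H p) ` V)"
        "mac e \<rho> \<le> fn.dim ((\<lambda>\<phi>. lact r (H p) (lact r (G p) \<phi>)) ` V)"
        "\<rho> + mac (Suc e) (c - \<rho>) \<le> fn.dim (T p ` V)"
        using gen_ex[OF gen_conj[OF gen_conj[OF gen1 gen2] gen_conj[OF gen3 gen4]]] by blast
      let ?W = "lact r (G p) ` V"
      have dG: "fn.dim ?W = \<rho>" and dH: "fn.dim (lact r (H p) ` V) = \<rho>"
        using p(1,2) max antisym by blast+
      have "fn.dim ?W = fn.dim {x \<in> ?W. lact r (H p) x = 0} + fn.dim (lact r (H p) ` ?W)"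
        by (rule fn2.rank_nullity[OF flinear_lact subI fdI])
      \<comment> \<open>This is the upper bound for the part of \<open>?W\<close> killed by
        \<open>H p\<close>; it uses Green's theorem in degree \<open>e\<close> for a space of
        dimension \<open>\<rho>\<close>.\<close>
      then have up: "fn.dim {x \<in> ?W. lact r (H p) x = 0} + mac e \<rho> \<le> \<rho>"
        using dG p(3) by (simp add: image_image)
      have "lact r (G p) ` ?K (H p) \<subseteq> {x \<in> ?W. lact r (H p) x = 0}"
      proof
        fix y assume "y \<in> lact r (G p) ` ?K (H p)"
        then obtain x where x: "x \<in> V" "lact r (H p) x = 0" "y = lact r (G p) x" by blast
        then have "lact r (H p) y = 0"
          by (subst x(3), subst lact_commute) (simp add: lact_def fun_eq_iff)
        then show "y \<in> {x \<in> ?W. lact r (H p) x = 0}" using x by blast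
      qed
      then have "fn.dim (lact r (G p) ` ?K (H p)) \<le> fn.dim {x \<in> ?W. lact r (H p) x = 0}"
        by (rule fn.fin_dim_mono[rotated]) (rule fn.fin_dim_subset[OF fdI[of "G p"]], auto)
      \<comment> \<open>Since \<open>H p\<close> has rank exactly \<open>\<rho>\<close>, what the
        rank of \<open>T p\<close> exceeds \<open>\<rho>\<close> by is the rank of
        \<open>G p\<close> on the kernel.\<close>
      moreover have "mac (Suc e) (c - \<rho>) \<le> fn.dim (lact r (G p) ` ?K (H p))"
        using rn[of "H p"] dH rnT[of p] kerT[of p] p(4) rnK[of "H p" "G p"] by simp
      ultimately have "mac (Suc e) (c - \<rho>) + mac e \<rho> \<le> \<rho>" using up by simp
      then have "mac (Suc e) (c - \<rho> + \<rho>) \<le> \<rho>" by (rule mac_add_le)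
      then show ?thesis using \<rho>c g0 by (auto simp: c_def intro!: exI[of _ g0])
    qed
  qed
qed

subsection \<open>Inverse systems\<close>

text \<open>The exponent type is general because the pairing also evaluates polynomials in the
  coefficients of a form.\<close>

definition ev :: "('a \<Rightarrow> 'k::comm_ring_1) \<Rightarrow> ('a \<Rightarrow>\<^sub>0 'k) \<Rightarrow> 'k" where
  "ev \<phi> f = (\<Sum>\<alpha>\<in>Poly_Mapping.keys f. Poly_Mapping.lookup f \<alpha> * \<phi> \<alpha>)"

lemma ev_superset:
  assumes "finite A" "Poly_Mapping.keys f \<subseteq> A"
  shows "ev \<phi> f = (\<Sum>\<alpha>\<in>A. Poly_Mapping.lookup f \<alpha> * \<phi> \<alpha>)"
  unfolding ev_def using assms by (intro sum.mono_neutral_left) (auto simp: in_keys_iff)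

lemma ev_zero [simp]: "ev \<phi> 0 = 0"
  by (simp add: ev_def)

lemma ev_single [simp]: "ev \<phi> (Poly_Mapping.single \<alpha> c) = c * \<phi> \<alpha>"
  by (simp add: ev_def)

lemma ev_add: "ev \<phi> (f + g) = ev \<phi> f + ev \<phi> g"
proof -
  let ?A = "Poly_Mapping.keys f \<union> Poly_Mapping.keys g"
  have "Poly_Mapping.keys (f + g) \<subseteq> ?A" by (rule keys_add)
  then show ?thesis
    using ev_superset[of ?A "f + g" \<phi>] ev_superset[of ?A f \<phi>] ev_superset[of ?A g \<phi>]
    by (simp add: lookup_add algebra_simps sum.distrib)
qed

lemma ev_sum: "ev \<phi> (\<Sum>i\<in>A. f i) = (\<Sum>i\<in>A. ev \<phi> (f i))"
  by (induction A rule: infinite_finite_induct) (simp_all add: ev_add)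

lemma poly_mapping_expansion:
  fixes f :: "'a \<Rightarrow>\<^sub>0 'k::comm_monoid_add"
  assumes "finite A" "Poly_Mapping.keys f \<subseteq> A"
  shows "f = (\<Sum>\<alpha>\<in>A. Poly_Mapping.single \<alpha> (Poly_Mapping.lookup f \<alpha>))"
proof (rule poly_mapping_eqI)
  fix \<beta>
  have "(\<Sum>\<alpha>\<in>A. Poly_Mapping.lookup (Poly_Mapping.single \<alpha> (Poly_Mapping.lookup f \<alpha>)) \<beta>)
      = (\<Sum>\<alpha>\<in>A. if \<beta> = \<alpha> then Poly_Mapping.lookup f \<alpha> else 0)"
    by (intro sum.cong) (auto simp: lookup_single when_def)
  also have "\<dots> = Poly_Mapping.lookup f \<beta>"
    using assms by (auto simp: in_keys_iff)
  finally show "Poly_Mapping.lookup f \<beta> = Poly_Mapping.lookup (\<Sum>\<alpha>\<in>A. Poly_Mapping.single \<alpha> (Poly_Mapping.lookup f \<alpha>)) \<beta>"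
    by (simp add: lookup_sum)
qed

lemma ev_mult:
  fixes f g :: "'a::monoid_add \<Rightarrow>\<^sub>0 'k::comm_ring_1"
  shows "ev \<phi> (f * g) = (\<Sum>\<alpha>\<in>Poly_Mapping.keys f. \<Sum>\<beta>\<in>Poly_Mapping.keys g.
    Poly_Mapping.lookup f \<alpha> * (Poly_Mapping.lookup g \<beta> * \<phi> (\<alpha> + \<beta>)))"
proof -
  have "f * g = (\<Sum>\<alpha>\<in>Poly_Mapping.keys f. Poly_Mapping.single \<alpha> (Poly_Mapping.lookup f \<alpha>)) *
     (\<Sum>\<beta>\<in>Poly_Mapping.keys g. Poly_Mapping.single \<beta> (Poly_Mapping.lookup g \<beta>))"
    using poly_mapping_expansion[of "Poly_Mapping.keys f" f] poly_mapping_expansion[of "Poly_Mapping.keys g" g]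
    by simp
  then show ?thesis
    by (simp add: sum_product ev_sum mult_single mult.assoc)
qed

text \<open>Covers evaluation at points: of polynomials in coefficients, and of forms at a point of
  a coordinate line.\<close>

lemma ev_mult_hom:
  fixes f g :: "'a::monoid_add \<Rightarrow>\<^sub>0 'k::comm_ring_1"
  assumes "\<And>\<alpha> \<beta>. \<phi> (\<alpha> + \<beta>) = \<phi> \<alpha> * \<phi> \<beta>"
  shows "ev \<phi> (f * g) = ev \<phi> f * ev \<phi> g"
  unfolding ev_mult assms by (simp add: ev_def sum_product mult_ac)

lemma const_add: "const (a + b) = const a + const b"
  by (simp add: const_def single_add)

lemma const_mult: "const a * const b = const (a * b)"
  by (simp add: const_def mult_single)

lemma const_0 [simp]: "const 0 = 0"
  by (simp add: const_def)

lemma const_1 [simp]: "const 1 = 1"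
  by (simp add: const_def)

lemma const_sum: "const (\<Sum>i\<in>A. f i) = (\<Sum>i\<in>A. const (f i))"
  by (induction A rule: infinite_finite_induct) (simp_all add: const_add)

lemma const_times_single: "const c * Poly_Mapping.single \<alpha> d = Poly_Mapping.single \<alpha> (c * d)"
  by (simp add: const_def mult_single)

lemma ev_uminus: "ev \<phi> (- f) = - ev \<phi> f"
  by (simp add: ev_def sum_negf)

lemma ev_diff: "ev \<phi> (f - g) = ev \<phi> f - ev \<phi> g"
  using ev_add[of \<phi> f "- g"] by (simp add: ev_uminus)

text \<open>The contraction action: \<open>act F\<close> is dual to multiplication by \<open>F\<close>.\<close>

definition act :: "'k::comm_ring_1 mpoly \<Rightarrow> ((nat \<Rightarrow>\<^sub>0 nat) \<Rightarrow> 'k) \<Rightarrow> (nat \<Rightarrow>\<^sub>0 nat) \<Rightarrow> 'k" where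
  "act F \<phi> = (\<lambda>m. ev (\<lambda>\<alpha>. \<phi> (m + \<alpha>)) F)"

lemma ev_act: "ev (act F \<phi>) g = ev \<phi> (F * g)"
proof -
  have "ev (act F \<phi>) g = (\<Sum>\<beta>\<in>Poly_Mapping.keys g. \<Sum>\<alpha>\<in>Poly_Mapping.keys F.
    Poly_Mapping.lookup g \<beta> * (Poly_Mapping.lookup F \<alpha> * \<phi> (\<beta> + \<alpha>)))"
    by (simp add: ev_def act_def sum_distrib_left)
  also have "\<dots> = ev \<phi> (g * F)" by (simp add: ev_mult)
  finally show ?thesis by (simp add: mult.commute)
qed

lemma ev_const_times: "ev \<phi> (const c * f) = c * ev \<phi> f"
proof -
  have "ev \<phi> (const c * f) = ev (act (const c) \<phi>) f" by (simp add: ev_act)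
  also have "act (const c) \<phi> = (\<lambda>m. c * \<phi> m)" by (simp add: act_def const_def)
  finally show ?thesis by (simp add: ev_def sum_distrib_left mult_ac)
qed

lemma act_eq_ev: "act F \<phi> m = ev \<phi> (F * Poly_Mapping.single m 1)"
  using ev_act[of F \<phi> "Poly_Mapping.single m 1"] by simp

lemma act_mult: "act (F * G) \<phi> = act F (act G \<phi>)"
  by (rule ext) (simp add: act_eq_ev[of "F * G"] act_eq_ev[of F "act G \<phi>"] ev_act ac_simps)

lemma act_1 [simp]: "act 1 \<phi> = \<phi>"
  by (rule ext) (simp add: act_eq_ev)

lemma forms_iff: "f \<in> forms r d \<longleftrightarrow> Poly_Mapping.keys f \<subseteq> mons r d"
  by (auto simp: forms_def mons_def)

lemma forms_zero: "0 \<in> forms r d"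
  by (simp add: forms_iff)

lemma forms_add: "f \<in> forms r d \<Longrightarrow> g \<in> forms r d \<Longrightarrow> f + g \<in> forms r d"
  using keys_add[of f g] by (auto simp: forms_iff)

lemma forms_mult: "f \<in> forms r d \<Longrightarrow> g \<in> forms r e \<Longrightarrow> f * g \<in> forms r (d + e)"
  using keys_mult[of f g] mons_add by (fastforce simp: forms_iff)

lemma forms_sum: "(\<And>i. i \<in> A \<Longrightarrow> f i \<in> forms r d) \<Longrightarrow> (\<Sum>i\<in>A. f i) \<in> forms r d"
  by (induction A rule: infinite_finite_induct) (simp_all add: forms_zero forms_add)

lemma forms_single: "\<alpha> \<in> mons r d \<Longrightarrow> Poly_Mapping.single \<alpha> c \<in> forms r d"
  by (simp add: forms_iff)

lemma const_forms: "const c \<in> forms r 0"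
  by (simp add: forms_iff const_def)

lemma one_forms: "1 \<in> forms r 0"
  by (simp add: forms_iff)

lemma forms_const_times: "f \<in> forms r d \<Longrightarrow> const c * f \<in> forms r d"
  using forms_mult[OF const_forms, of f r d c] by simp

lemma forms_diff: "f \<in> forms r d \<Longrightarrow> g \<in> forms r d \<Longrightarrow> f - g \<in> forms r d"
  for f :: "'k::comm_ring_1 mpoly"
  using forms_add[of f r d "const (-1) * g"] forms_const_times[of g r d "-1"]
  by (simp add: const_def single_uminus)

lemma forms_subset_polys: "f \<in> forms r d \<Longrightarrow> f \<in> polys r"
  by (auto simp: forms_def polys_def)

lemma flinear_act: "flinear (act F)"
  by (rule flinearI) (simp_all add: act_def ev_def algebra_simps sum.distrib sum_distrib_left)

lemma act_fsupp:
  assumes "F \<in> forms r d" "\<phi> \<in> fsupp (mons r (i + d))"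
  shows "act F \<phi> \<in> fsupp (mons r i)"
  unfolding fsupp_def
proof (intro CollectI allI impI)
  fix m assume m: "m \<notin> mons r i"
  have "\<phi> (m + \<alpha>) = 0" if "\<alpha> \<in> Poly_Mapping.keys F" for \<alpha>
    using that m assms mons_add_cancel[of \<alpha> m r d i] by (force simp: forms_iff fsupp_def add.commute)
  then show "act F \<phi> m = 0" unfolding act_def ev_def by (intro sum.neutral) simp
qed

definition lform :: "nat \<Rightarrow> (nat \<Rightarrow> 'k) \<Rightarrow> 'k::comm_ring_1 mpoly" where
  "lform r a = (\<Sum>j<r. Poly_Mapping.single (evar j) (a j))"

lemma lform_forms: "lform r a \<in> forms r (Suc 0)"
  unfolding lform_def by (intro forms_sum forms_single) (auto simp: mons_def)

lemma act_lform: "act (lform r a) = lact r a"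
  by (intro ext) (simp add: act_def lact_def lform_def ev_sum)

text \<open>\<open>F\<close> is a product of linear forms chosen one by one from the top degree
  down; \<open>b\<close> is any sequence of dimensions that Green's bound can sustain.\<close>

lemma green_iterate:
  fixes V :: "((nat \<Rightarrow>\<^sub>0 nat) \<Rightarrow> 'k::field_char_0) set"
  assumes "fn.subspace V" "V \<subseteq> fsupp (mons r (i + d))" "b (i + d) \<le> fn.dim V"
    and "\<And>j. i \<le> j \<Longrightarrow> j < i + d \<Longrightarrow> b j \<le> mac (Suc j) (b (Suc j))"
  shows "\<exists>F\<in>forms r d. b i \<le> fn.dim (act F ` V)"
  using assms
proof (induction d arbitrary: V)
  case 0
  then show ?case using one_forms by (intro bexI[of _ 1]) auto
next
  case (Suc d)
  obtain a where a: "mac (Suc (i + d)) (fn.dim V) \<le> fn.dim (lact r a ` V)"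
    using green[OF Suc.prems(1), of r "Suc (i + d)"] Suc.prems(2) by auto
  let ?W = "lact r a ` V"
  have "b (i + d) \<le> mac (Suc (i + d)) (b (Suc (i + d)))" using Suc.prems(4) by simp
  also have "\<dots> \<le> mac (Suc (i + d)) (fn.dim V)" using Suc.prems(3) by (intro mac_mono) simp
  also note a
  finally have "b (i + d) \<le> fn.dim ?W" .
  moreover have "fn.subspace ?W" by (rule fn2.linear_subspace_image[OF flinear_lact Suc.prems(1)])
  moreover have "?W \<subseteq> fsupp (mons r (i + d))" using Suc.prems(2) lact_fsupp by fastforce
  ultimately obtain F where F: "F \<in> forms r d" "b i \<le> fn.dim (act F ` ?W)"
    using Suc.IH[of ?W] Suc.prems(4) by auto
  have "act (F * lform r a) ` V = act F ` ?W"
    by (simp add: act_mult act_lform image_image)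
  moreover have "F * lform r a \<in> forms r (Suc d)"
    using forms_mult[OF F(1) lform_forms] by simp
  ultimately show ?case using F(2) by metis
qed

section \<open>Linear subspaces and double annihilators\<close>

text \<open>Weaker than an ideal, since \<open>mult_max_rank_surjI\<close> needs the inverse system
  of \<open>I\<close> plus the multiples of \<open>F\<close> in one degree.\<close>

definition lin_sub :: "'k::comm_ring_1 mpoly set \<Rightarrow> bool" where
  "lin_sub U \<longleftrightarrow> 0 \<in> U \<and> (\<forall>f\<in>U. \<forall>g\<in>U. f + g \<in> U) \<and> (\<forall>c. \<forall>f\<in>U. const c * f \<in> U)"

lemma lin_sub_zero: "lin_sub U \<Longrightarrow> 0 \<in> U"
  and lin_sub_add: "lin_sub U \<Longrightarrow> f \<in> U \<Longrightarrow> g \<in> U \<Longrightarrow> f + g \<in> U"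
  and lin_sub_const: "lin_sub U \<Longrightarrow> f \<in> U \<Longrightarrow> const c * f \<in> U"
  by (auto simp: lin_sub_def)

lemma lin_sub_uminus: "lin_sub U \<Longrightarrow> f \<in> U \<Longrightarrow> - f \<in> U"
  using lin_sub_const[of U f "-1"] by (simp add: const_def single_uminus)

lemma lin_sub_diff: "lin_sub U \<Longrightarrow> f \<in> U \<Longrightarrow> g \<in> U \<Longrightarrow> f - g \<in> U"
  using lin_sub_add[of U f "- g"] lin_sub_uminus[of U g] by simp

lemma lin_sub_sum: "lin_sub U \<Longrightarrow> (\<And>i. i \<in> A \<Longrightarrow> f i \<in> U) \<Longrightarrow> (\<Sum>i\<in>A. f i) \<in> U"
  by (induction A rule: infinite_finite_induct) (simp_all add: lin_sub_zero lin_sub_add)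

lemma homogeneous_ideal_lin_sub:
  assumes "homogeneous_ideal r I" shows "lin_sub I"
proof -
  have "const c \<in> polys r" for c :: 'a using const_forms forms_subset_polys by blast
  then show ?thesis using assms unfolding homogeneous_ideal_def lin_sub_def by blast
qed

lemma homogeneous_ideal_mult:
  "homogeneous_ideal r I \<Longrightarrow> f \<in> I \<Longrightarrow> g \<in> forms r d \<Longrightarrow> g * f \<in> I"
  using forms_subset_polys unfolding homogeneous_ideal_def by blast

text \<open>The degree \<open>j\<close> part of the inverse system of \<open>U\<close>.\<close>

definition ann :: "nat \<Rightarrow> 'k::field mpoly set \<Rightarrow> nat \<Rightarrow> ((nat \<Rightarrow>\<^sub>0 nat) \<Rightarrow> 'k) set" where
  "ann r U j = {\<phi> \<in> fsupp (mons r j). \<forall>f\<in>U \<inter> forms r j. ev \<phi> f = 0}"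

lemma subspace_ann: "fn.subspace (ann r U j)"
proof -
  have "ev (\<lambda>x. 0) f = 0" "ev (\<lambda>x. \<phi> x + \<psi> x) f = ev \<phi> f + ev \<psi> f" "ev (\<lambda>x. c * \<phi> x) f = c * ev \<phi> f"
    for \<phi> \<psi> c and f :: "'a mpoly"
    by (simp_all add: ev_def algebra_simps sum.distrib sum_distrib_left)
  then show ?thesis
    by (auto simp: fn.subspace_def ann_def fsupp_def fscale_def plus_fun_def zero_fun_def)
qed

lemma ann_subset: "ann r U j \<subseteq> fsupp (mons r j)"
  by (auto simp: ann_def)

lemma fin_dim_ann: "fn.fin_dim (ann r U j)"
  using fin_dim_fsupp[OF finite_mons] ann_subset by (rule fn.fin_dim_subset)

lemma form_reduce:
  assumes U: "lin_sub U" and f: "f \<in> forms r d"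
    and C: "\<And>m. m \<in> mons r d \<Longrightarrow> Poly_Mapping.single m 1 - (\<Sum>b\<in>B. const (C m b) * b) \<in> U"
  shows "f - (\<Sum>b\<in>B. const (\<Sum>m\<in>mons r d. Poly_Mapping.lookup f m * C m b) * b) \<in> U"
proof -
  let ?x = "\<lambda>m. Poly_Mapping.single m (1::'a)" and ?a = "Poly_Mapping.lookup f"
  have f1: "f = (\<Sum>m\<in>mons r d. const (?a m) * ?x m)"
    using poly_mapping_expansion[of "mons r d" f] f by (simp add: forms_iff const_times_single)
  have "(\<Sum>m\<in>mons r d. const (?a m) * (?x m - (\<Sum>b\<in>B. const (C m b) * b))) \<in> U"
    using C by (intro lin_sub_sum[OF U] lin_sub_const[OF U]) auto
  also have "(\<Sum>m\<in>mons r d. const (?a m) * (?x m - (\<Sum>b\<in>B. const (C m b) * b)))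
     = (\<Sum>m\<in>mons r d. const (?a m) * ?x m) - (\<Sum>m\<in>mons r d. \<Sum>b\<in>B. const (?a m * C m b) * b)"
    by (simp add: right_diff_distrib sum_subtractf sum_distrib_left mult.assoc[symmetric] const_mult)
  also have "\<dots> = f - (\<Sum>m\<in>mons r d. \<Sum>b\<in>B. const (?a m * C m b) * b)"
    unfolding f1[symmetric] ..
  also have "(\<Sum>m\<in>mons r d. \<Sum>b\<in>B. const (?a m * C m b) * b)
     = (\<Sum>b\<in>B. const (\<Sum>m\<in>mons r d. ?a m * C m b) * b)"
    by (subst sum.swap) (simp add: const_sum sum_distrib_right)
  finally show ?thesis .
qed

text \<open>\<open>hilb\<close> is a \<open>LEAST\<close> over cardinalities of bases, so a basis
  must be exhibited: a maximal set of monomials independent modulo \<open>U\<close>.\<close>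

lemma basis_mod_exists:
  assumes U: "lin_sub U"
  shows "\<exists>B. basis_mod r U d B"
proof -
  define S :: "'a mpoly set" where "S = (\<lambda>m. Poly_Mapping.single m 1) ` mons r d"
  define ind where "ind B \<longleftrightarrow> (\<forall>c. (\<Sum>b\<in>B. const (c b) * b) \<in> U \<longrightarrow> (\<forall>b\<in>B. c b = 0))" for B :: "'a mpoly set"
  have finS: "finite S" by (simp add: S_def)
  let ?X = "{B. B \<subseteq> S \<and> ind B}"
  have fX: "finite ?X" using finS by simp
  have eX: "{} \<in> ?X" by (simp add: ind_def)
  from finite_has_maximal2[OF fX eX] obtain B where BX: "B \<in> ?X" and max0: "\<forall>C\<in>?X. B \<subseteq> C \<longrightarrow> B = C"
    by blast
  have B: "B \<subseteq> S" "ind B" using BX by simp_all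
  have max: "B = C" if "C \<subseteq> S" "ind C" "B \<subseteq> C" for C using max0 that by simp
  have finB: "finite B" using B finS finite_subset by blast
  have "\<exists>c. s - (\<Sum>b\<in>B. const (c b) * b) \<in> U" if s: "s \<in> S" for s
  proof (cases "s \<in> B")
    case True
    have "(\<Sum>b\<in>B. const (if b = s then 1 else 0) * b) = (\<Sum>b\<in>B. if b = s then b else 0)"
      by (intro sum.cong) auto
    also have "\<dots> = s" using True finB by simp
    finally show ?thesis using lin_sub_zero[OF U] by (intro exI[of _ "\<lambda>b. if b = s then 1 else 0"]) simp
  next
    case False
    then have "\<not> ind (insert s B)" using max[of "insert s B"] s B by blast
    then obtain c b0 where c: "(\<Sum>b\<in>insert s B. const (c b) * b) \<in> U" "b0 \<in> insert s B" "c b0 \<noteq> 0"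
      unfolding ind_def by blast
    have c': "const (c s) * s + (\<Sum>b\<in>B. const (c b) * b) \<in> U" using c(1) False finB by simp
    have "c s \<noteq> 0"
    proof
      assume z: "c s = 0"
      then have "\<forall>b\<in>B. c b = 0" using c' B(2) unfolding ind_def by simp
      then show False using z c by auto
    qed
    have "const (1 / c s) * (const (c s) * s + (\<Sum>b\<in>B. const (c b) * b)) \<in> U"
      by (rule lin_sub_const[OF U c'])
    also have "const (1 / c s) * (const (c s) * s + (\<Sum>b\<in>B. const (c b) * b)) =
        s - (\<Sum>b\<in>B. const (- c b / c s) * b)"
    proof -
      have "const (1 / c s) * (const (c s) * s) = s"
        using \<open>c s \<noteq> 0\<close> by (simp add: mult.assoc[symmetric] const_mult)
      moreover have "const (1 / c s) * (\<Sum>b\<in>B. const (c b) * b) = - (\<Sum>b\<in>B. const (- c b / c s) * b)"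
        by (simp add: sum_distrib_left mult.assoc[symmetric] const_mult sum_negf[symmetric])
          (simp add: const_def single_uminus)
      ultimately show ?thesis by (simp add: distrib_left)
    qed
    finally show ?thesis by (intro exI[of _ "\<lambda>b. - c b / c s"])
  qed
  then have "\<forall>s. \<exists>c. s \<in> S \<longrightarrow> s - (\<Sum>b\<in>B. const (c b) * b) \<in> U" by blast
  from choice[OF this] obtain C where C: "\<And>s. s \<in> S \<Longrightarrow> s - (\<Sum>b\<in>B. const (C s b) * b) \<in> U" by blast
  have "\<exists>c. f - (\<Sum>b\<in>B. const (c b) * b) \<in> U" if f: "f \<in> forms r d" for f
    using form_reduce[OF U f, of "\<lambda>m. C (Poly_Mapping.single m 1)" B] C by (fastforce simp: S_def)
  moreover have "B \<subseteq> forms r d" using B(1) by (auto simp: S_def intro: forms_single)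
  ultimately have "basis_mod r U d B"
    using finB B(2) unfolding basis_mod_def ind_def by blast
  then show ?thesis by blast
qed

text \<open>The coordinate functions modulo \<open>U\<close> form the basis of the inverse system
  dual to \<open>B\<close>. A form killed by all of them has zero coordinates, hence lies in
  \<open>U\<close>.\<close>

lemma basis_mod_dual:
  assumes U: "lin_sub U" and B: "basis_mod r U d B"
  shows "fn.dim (ann r U d) = card B"
    and "\<And>g. g \<in> forms r d \<Longrightarrow> (\<And>\<psi>. \<psi> \<in> ann r U d \<Longrightarrow> ev \<psi> g = 0) \<Longrightarrow> g \<in> U"
proof -
  let ?x = "\<lambda>m. Poly_Mapping.single m (1::'a)"
  have fin: "finite B" and Bf: "B \<subseteq> forms r d"
    and ind: "\<And>c b. (\<Sum>b\<in>B. const (c b) * b) \<in> U \<Longrightarrow> b \<in> B \<Longrightarrow> c b = 0"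
    and sp: "\<And>f. f \<in> forms r d \<Longrightarrow> \<exists>c. f - (\<Sum>b\<in>B. const (c b) * b) \<in> U"
    using B unfolding basis_mod_def by blast+
  have "\<forall>m. \<exists>c. m \<in> mons r d \<longrightarrow> ?x m - (\<Sum>b\<in>B. const (c b) * b) \<in> U"
    using sp forms_single by blast
  from choice[OF this] obtain C where C: "\<And>m. m \<in> mons r d \<Longrightarrow> ?x m - (\<Sum>b\<in>B. const (C m b) * b) \<in> U"
    by blast
  define \<Phi> where "\<Phi> b = (\<lambda>m. if m \<in> mons r d then C m b else 0)" for b
  have K: "f - (\<Sum>b\<in>B. const (ev (\<Phi> b) f) * b) \<in> U" if f: "f \<in> forms r d" for f
  proof -
    let ?a = "Poly_Mapping.lookup f"
    have "ev (\<Phi> b) f = (\<Sum>m\<in>mons r d. ?a m * C m b)" for b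
      using ev_superset[of "mons r d" f "\<Phi> b"] f by (simp add: forms_iff \<Phi>_def)
    then show ?thesis using form_reduce[OF U f C] by simp
  qed
  have annP: "\<Phi> b \<in> ann r U d" if b: "b \<in> B" for b
    unfolding ann_def
  proof (intro CollectI conjI ballI)
    show "\<Phi> b \<in> fsupp (mons r d)" by (simp add: fsupp_def \<Phi>_def)
    fix f assume f: "f \<in> U \<inter> forms r d"
    have "f - (f - (\<Sum>b\<in>B. const (ev (\<Phi> b) f) * b)) \<in> U"
      using f by (intro lin_sub_diff[OF U] K) simp_all
    then have "(\<Sum>b\<in>B. const (ev (\<Phi> b) f) * b) \<in> U" by simp
    from ind[OF this b] show "ev (\<Phi> b) f = 0" .
  qed
  have dual: "ev (\<Phi> b) b' = (if b = b' then 1 else 0)" if b: "b \<in> B" "b' \<in> B" for b b'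
  proof -
    have "b' = (\<Sum>b\<in>B. const (if b = b' then 1 else 0) * b)"
    proof -
      have "(\<Sum>b\<in>B. const (if b = b' then 1 else 0) * b) = (\<Sum>b\<in>B. if b = b' then b else 0)"
        by (intro sum.cong) auto
      then show ?thesis using b fin by simp
    qed
    then have "b' - (\<Sum>b\<in>B. const (ev (\<Phi> b) b') * b)
      = (\<Sum>b\<in>B. const (if b = b' then 1 else 0) * b) - (\<Sum>b\<in>B. const (ev (\<Phi> b) b') * b)" by simp
    also have "\<dots> = (\<Sum>b\<in>B. const ((if b = b' then 1 else 0) - ev (\<Phi> b) b') * b)"
      by (simp add: sum_subtractf[symmetric] left_diff_distrib[symmetric] const_def single_diff)
    finally have "(\<Sum>b\<in>B. const ((if b = b' then 1 else 0) - ev (\<Phi> b) b') * b) \<in> U"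
      using K[of b'] b Bf by auto
    from ind[OF this b(1)] show ?thesis by simp
  qed
  have expand: "\<phi> = (\<Sum>b\<in>B. fscale (ev \<phi> b) (\<Phi> b))" if \<phi>: "\<phi> \<in> ann r U d" for \<phi>
  proof
    fix m
    show "\<phi> m = (\<Sum>b\<in>B. fscale (ev \<phi> b) (\<Phi> b)) m"
    proof (cases "m \<in> mons r d")
      case True
      have "?x m - (\<Sum>b\<in>B. const (C m b) * b) \<in> forms r d"
        using True Bf by (intro forms_diff forms_single forms_sum forms_const_times) auto
      then have "ev \<phi> (?x m - (\<Sum>b\<in>B. const (C m b) * b)) = 0"
        using \<phi> C[OF True] by (auto simp: ann_def)
      then have "\<phi> m = (\<Sum>b\<in>B. C m b * ev \<phi> b)"
        by (simp add: ev_diff ev_sum ev_const_times)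
      then show ?thesis using True
        by (simp add: sum_fun_apply fscale_def \<Phi>_def mult.commute)
    next
      case False
      then show ?thesis using \<phi> by (simp add: ann_def fsupp_def sum_fun_apply fscale_def \<Phi>_def)
    qed
  qed
  have inj: "inj_on \<Phi> B"
  proof (rule inj_onI)
    fix b b' assume b: "b \<in> B" "b' \<in> B" "\<Phi> b = \<Phi> b'"
    have "ev (\<Phi> b) b = 1" "ev (\<Phi> b') b = (if b' = b then 1 else 0)"
      using dual b(1,2) by simp_all
    then show "b = b'" unfolding b(3) by (metis zero_neq_one)
  qed
  have evs: "ev (\<Sum>b\<in>B. fscale (c b) (\<Phi> b)) b' = c b'" if "b' \<in> B" for c b'
  proof -
    have "ev (\<Sum>b\<in>B. fscale (c b) (\<Phi> b)) b' = (\<Sum>\<alpha>\<in>Poly_Mapping.keys b'. \<Sum>b\<in>B.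
        c b * (Poly_Mapping.lookup b' \<alpha> * \<Phi> b \<alpha>))"
      by (simp add: ev_def sum_fun_apply fscale_def sum_distrib_left mult.left_commute)
    also have "\<dots> = (\<Sum>b\<in>B. c b * ev (\<Phi> b) b')"
      by (subst sum.swap) (simp add: ev_def sum_distrib_left)
    also have "\<dots> = (\<Sum>b\<in>B. if b = b' then c b else 0)" using dual that by (intro sum.cong) auto
    finally show ?thesis using that fin by simp
  qed
  have "fn.independent (\<Phi> ` B)"
  proof (rule fn.independent_if_scalars_zero)
    fix c y assume c: "(\<Sum>y\<in>\<Phi> ` B. fscale (c y) y) = 0" and "y \<in> \<Phi> ` B"
    then obtain b where b: "b \<in> B" "y = \<Phi> b" by blast
    have "(\<Sum>b\<in>B. fscale (c (\<Phi> b)) (\<Phi> b)) = 0" using c by (simp add: sum.reindex[OF inj])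
    then have "ev 0 b = c (\<Phi> b)" using evs[OF b(1), of "\<lambda>b. c (\<Phi> b)"] by simp
    then show "c y = 0" using b by (simp add: ev_def)
  qed (use fin in simp)
  moreover have "ann r U d \<subseteq> fn.span (\<Phi> ` B)"
  proof
    fix \<phi> assume "\<phi> \<in> ann r U d"
    then have "\<phi> = (\<Sum>b\<in>B. fscale (ev \<phi> b) (\<Phi> b))" by (rule expand)
    also have "\<dots> \<in> fn.span (\<Phi> ` B)" by (intro fn.span_sum fn.span_scale fn.span_base) auto
    finally show "\<phi> \<in> fn.span (\<Phi> ` B)" .
  qed
  ultimately have "card (\<Phi> ` B) = fn.dim (ann r U d)"
    using annP by (intro fn.basis_card_eq_dim) auto
  then show "fn.dim (ann r U d) = card B" by (simp add: card_image[OF inj])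
  show "g \<in> U" if "g \<in> forms r d" "\<And>\<psi>. \<psi> \<in> ann r U d \<Longrightarrow> ev \<psi> g = 0" for g
  proof -
    have "(\<Sum>b\<in>B. const (ev (\<Phi> b) g) * b) = 0" using that(2)[OF annP] by (intro sum.neutral) simp
    then show ?thesis using K[OF that(1)] by simp
  qed
qed

lemma hilb_eq_dim_ann:
  assumes "homogeneous_ideal r I"
  shows "hilb r I d = fn.dim (ann r I d)"
proof -
  note U = homogeneous_ideal_lin_sub[OF assms]
  obtain B where B: "basis_mod r I d B" using basis_mod_exists[OF U] by blast
  have "card B' = fn.dim (ann r I d)" if "basis_mod r I d B'" for B'
    using basis_mod_dual(1)[OF U that] by simp
  then show ?thesis unfolding hilb_def
    by (intro Least_equality) (use B in auto)
qed

lemma double_ann: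
  assumes "lin_sub U" "g \<in> forms r d" "\<And>\<psi>. \<psi> \<in> ann r U d \<Longrightarrow> ev \<psi> g = 0"
  shows "g \<in> U"
proof -
  obtain B where "basis_mod r U d B" using basis_mod_exists[OF assms(1)] by blast
  then show ?thesis using assms(2,3) by (rule basis_mod_dual(2)[OF assms(1)])
qed

lemma act_ann:
  assumes I: "homogeneous_ideal r I" and F: "F \<in> forms r d" and \<phi>: "\<phi> \<in> ann r I (i + d)"
  shows "act F \<phi> \<in> ann r I i"
proof -
  have "ev \<phi> (F * f) = 0" if "f \<in> I" "f \<in> forms r i" for f
    using \<phi> homogeneous_ideal_mult[OF I that(1) F] forms_mult[OF F that(2)]
    by (auto simp: ann_def add.commute)
  then show ?thesis using \<phi> act_fsupp[OF F] by (auto simp: ann_def ev_act)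
qed

text \<open>The rank forces contraction by \<open>F\<close> onto the whole inverse system in degree
  \<open>i\<close>, so a \<open>g\<close> with \<open>F * g\<close> in \<open>I\<close> is
  annihilated by all of it.\<close>

lemma mult_max_rank_injI:
  assumes I: "homogeneous_ideal r I" and F: "F \<in> forms r d"
    and dim: "hilb r I i \<le> fn.dim (act F ` ann r I (i + d))"
  shows "mult_max_rank r I F d i"
proof -
  have "g \<in> I" if g: "g \<in> forms r i" "F * g \<in> I" for g
  proof -
    have "act F ` ann r I (i + d) = ann r I i"
    proof (rule fn.fin_dim_subspace_eq[OF fin_dim_ann])
      show "act F ` ann r I (i + d) \<subseteq> ann r I i" using act_ann[OF I F] by blast
      show "fn.subspace (act F ` ann r I (i + d))" by (rule fn2.linear_subspace_image[OF flinear_act subspace_ann])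
    qed (use dim in \<open>simp add: hilb_eq_dim_ann[OF I]\<close>)
    moreover have "ev (act F \<phi>) g = 0" if "\<phi> \<in> ann r I (i + d)" for \<phi>
      using that g forms_mult[OF F g(1)] by (simp add: ann_def ev_act add.commute)
    ultimately have "ev \<psi> g = 0" if "\<psi> \<in> ann r I i" for \<psi> using that by (metis imageE)
    then show ?thesis by (rule double_ann[OF homogeneous_ideal_lin_sub[OF I] g(1)])
  qed
  then show ?thesis unfolding mult_max_rank_def by blast
qed

text \<open>Contraction by \<open>F\<close> is injective, hence the inverse system of the space
  \<open>W\<close> of sums of elements of \<open>I\<close> and multiples of \<open>F\<close> is
  zero, and \<open>W\<close> contains every form of degree \<open>i + d\<close>.\<close>

lemma mult_max_rank_surjI:
  assumes I: "homogeneous_ideal r I" and F: "F \<in> forms r d"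
    and dim: "hilb r I (i + d) \<le> fn.dim (act F ` ann r I (i + d))"
  shows "mult_max_rank r I F d i"
proof -
  note U = homogeneous_ideal_lin_sub[OF I]
  let ?V = "ann r I (i + d)"
  have "fn.dim ?V = fn.dim {x \<in> ?V. act F x = 0} + fn.dim (act F ` ?V)"
    by (rule fn2.rank_nullity[OF flinear_act subspace_ann fin_dim_ann])
  then have "fn.dim {x \<in> ?V. act F x = 0} = 0" using dim by (simp add: hilb_eq_dim_ann[OF I])
  moreover have "fn.fin_dim {x \<in> ?V. act F x = 0}"
    by (rule fn.fin_dim_subset[OF fin_dim_ann[of r I "i + d"]]) auto
  ultimately have inj: "x = 0" if "x \<in> ?V" "act F x = 0" for x
    using fn.dim_pos[of "{x \<in> ?V. act F x = 0}" x] that by auto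
  define W where "W = {u + F * g | u g. u \<in> I \<and> g \<in> forms r i}"
  have W: "lin_sub W"
    unfolding lin_sub_def
  proof (intro conjI ballI allI)
    show "0 \<in> W" unfolding W_def using lin_sub_zero[OF U] forms_zero by force
    fix x y assume "x \<in> W"
    then obtain u g where u: "x = u + F * g" "u \<in> I" "g \<in> forms r i" unfolding W_def by blast
    have "const c * x = const c * u + F * (const c * g)" for c using u by (simp add: algebra_simps)
    then show "const c * x \<in> W" for c
      unfolding W_def using lin_sub_const[OF U u(2)] forms_const_times[OF u(3)] by blast
    assume "y \<in> W"
    then obtain v h where v: "y = v + F * h" "v \<in> I" "h \<in> forms r i" unfolding W_def by blast
    have "x + y = (u + v) + F * (g + h)" using u v by (simp add: algebra_simps)
    then show "x + y \<in> W"
      unfolding W_def using lin_sub_add[OF U u(2) v(2)] forms_add[OF u(3) v(3)] by blast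
  qed
  have "\<psi> = 0" if \<psi>: "\<psi> \<in> ann r W (i + d)" for \<psi>
  proof (rule inj)
    have "I \<subseteq> W"
    proof
      fix u assume "u \<in> I"
      moreover have "u = u + F * 0" by simp
      ultimately show "u \<in> W" unfolding W_def using forms_zero by blast
    qed
    then show "\<psi> \<in> ?V" using \<psi> by (auto simp: ann_def)
    show "act F \<psi> = 0"
    proof
      fix m show "act F \<psi> m = 0 m"
      proof (cases "m \<in> mons r i")
        case True
        let ?g = "Poly_Mapping.single m 1"
        have g: "?g \<in> forms r i" using True by (rule forms_single)
        have "F * ?g = 0 + F * ?g" by simp
        then have "F * ?g \<in> W" unfolding W_def using g lin_sub_zero[OF U] by blast
        moreover have "F * ?g \<in> forms r (i + d)" using forms_mult[OF F g] by (simp add: add.commute)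
        ultimately show ?thesis using \<psi> by (auto simp: act_eq_ev ann_def)
      next
        case False
        then show ?thesis using act_fsupp[OF F] \<psi> by (auto simp: ann_def fsupp_def)
      qed
    qed
  qed
  then have "ev \<psi> h = 0" if "\<psi> \<in> ann r W (i + d)" for \<psi> h
    using that by (fastforce simp: ev_def)
  then have "h \<in> W" if "h \<in> forms r (i + d)" for h
    using double_ann[OF W that] by blast
  then have "\<exists>g\<in>forms r i. h - F * g \<in> I" if h: "h \<in> forms r (i + d)" for h
  proof -
    obtain u g where "h = u + F * g" "u \<in> I" "g \<in> forms r i"
      using \<open>\<And>h. h \<in> forms r (i + d) \<Longrightarrow> h \<in> W\<close>[OF h] unfolding W_def by blast
    then show ?thesis by (intro bexI[of _ g]) simp_all
  qed
  then show ?thesis unfolding mult_max_rank_def by blast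
qed

section \<open>From polynomial functions to general forms\<close>

lemma polyfun_eval_coeff:
  fixes f :: "((nat \<Rightarrow>\<^sub>0 nat) \<Rightarrow> 'a::comm_ring_1) \<Rightarrow> 'a"
  assumes "f \<in> polyfun X"
  shows "\<exists>Q. \<forall>F. eval_coeff Q F = f (Poly_Mapping.lookup F)"
proof -
  \<comment> \<open>The value of a monomial in coefficients at \<open>F\<close>; being
    multiplicative, it turns \<open>eval_coeff\<close> into a ring homomorphism.\<close>
  define \<mu> where "\<mu> F = (\<lambda>m. \<Prod>\<alpha>\<in>Poly_Mapping.keys m. Poly_Mapping.lookup F \<alpha> ^ Poly_Mapping.lookup m \<alpha>)"
    for F :: "'a mpoly" and m :: "(nat \<Rightarrow>\<^sub>0 nat) \<Rightarrow>\<^sub>0 nat"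
  have ec: "eval_coeff Q F = ev (\<mu> F) Q" for Q and F :: "'a mpoly"
    by (simp add: eval_coeff_def ev_def \<mu>_def)
  have \<mu>_add: "\<mu> F (a + b) = \<mu> F a * \<mu> F b" for F a b
  proof -
    let ?A = "Poly_Mapping.keys a \<union> Poly_Mapping.keys b"
    have sup: "\<mu> F c = (\<Prod>\<alpha>\<in>?A. Poly_Mapping.lookup F \<alpha> ^ Poly_Mapping.lookup c \<alpha>)"
      if "Poly_Mapping.keys c \<subseteq> ?A" for c
      unfolding \<mu>_def using that by (intro prod.mono_neutral_left) (auto simp: in_keys_iff)
    show ?thesis
      using sup[of a] sup[of b] sup[of "a + b"]
      by (simp add: keys_add_nat lookup_add power_add prod.distrib)
  qed
  show ?thesis using assms
  proof induction
    case (polyfun_const c)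
    have "\<forall>F. eval_coeff (Poly_Mapping.single 0 c) F = c" by (simp add: ec \<mu>_def)
    then show ?case by blast
  next
    case (polyfun_coord i)
    have "\<forall>F. eval_coeff (Poly_Mapping.single (Poly_Mapping.single i 1) (1::'a)) F = Poly_Mapping.lookup F i"
      by (simp add: ec \<mu>_def)
    then show ?case by blast
  next
    case (polyfun_add f g)
    then obtain P Q where "\<forall>F. eval_coeff P F = f (Poly_Mapping.lookup F)"
      "\<forall>F. eval_coeff Q F = g (Poly_Mapping.lookup F)" by blast
    then have "\<forall>F. eval_coeff (P + Q) F = f (Poly_Mapping.lookup F) + g (Poly_Mapping.lookup F)"
      by (simp add: ec ev_add)
    then show ?case by blast
  next
    case (polyfun_mult f g)
    then obtain P Q where PQ: "\<forall>F. eval_coeff P F = f (Poly_Mapping.lookup F)"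
      "\<forall>F. eval_coeff Q F = g (Poly_Mapping.lookup F)" by blast
    have "ev (\<mu> F) (P * Q) = ev (\<mu> F) P * ev (\<mu> F) Q" for F
      using \<mu>_add by (rule ev_mult_hom)
    then have "\<forall>F. eval_coeff (P * Q) F = f (Poly_Mapping.lookup F) * g (Poly_Mapping.lookup F)"
      using PQ by (simp add: ec)
    then show ?case by blast
  qed
qed

lemma gen_general_form:
  fixes P :: "'k::field mpoly \<Rightarrow> bool"
  assumes "gen (mons r d) P'" "\<And>F. F \<in> forms r d \<Longrightarrow> P' (Poly_Mapping.lookup F) \<Longrightarrow> P F"
  shows "general_form r d P"
proof -
  obtain f p where f: "f \<in> polyfun (mons r d)" "f p \<noteq> 0" "\<And>p. f p \<noteq> 0 \<Longrightarrow> P' p"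
    using assms(1) unfolding gen_def by blast
  obtain Q where Q: "\<And>F. eval_coeff Q F = f (Poly_Mapping.lookup F)"
    using polyfun_eval_coeff[OF f(1)] by blast
  \<comment> \<open>The point \<open>p\<close> may be nonzero outside \<open>mons r d\<close>;
    \<open>F0\<close> keeps the coordinates that \<open>f\<close> can see.\<close>
  define F0 where "F0 = (\<Sum>\<alpha>\<in>mons r d. Poly_Mapping.single \<alpha> (p \<alpha>))"
  have F0: "F0 \<in> forms r d" unfolding F0_def by (intro forms_sum forms_single)
  have "Poly_Mapping.lookup F0 \<beta> = p \<beta>" if "\<beta> \<in> mons r d" for \<beta>
  proof -
    have "Poly_Mapping.lookup F0 \<beta> = (\<Sum>\<alpha>\<in>mons r d. if \<alpha> = \<beta> then p \<alpha> else 0)"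
      unfolding F0_def lookup_sum by (intro sum.cong) (auto simp: lookup_single when_def)
    then show ?thesis using that by simp
  qed
  then have "f (Poly_Mapping.lookup F0) = f p" by (intro polyfun_cong_on[OF f(1)])
  then have "eval_coeff Q F0 \<noteq> 0" using Q f(2) by simp
  then show ?thesis unfolding general_form_def
    using Q F0 f(3) assms(2) by (intro exI[of _ Q]) auto
qed

lemma gen_dim_act:
  fixes V :: "((nat \<Rightarrow>\<^sub>0 nat) \<Rightarrow> 'k::field) set"
  assumes "F0 \<in> forms r d" "n \<le> fn.dim (act F0 ` V)" "fn.fin_dim V"
  shows "\<exists>P. gen (mons r d) P \<and> (\<forall>F\<in>forms r d. P (Poly_Mapping.lookup F) \<longrightarrow> n \<le> fn.dim (act F ` V))"
proof -
  \<comment> \<open>Extends \<open>act\<close> from forms to arbitrary coefficient vectors, the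
    parameter space of \<open>gen_dim_image\<close>.\<close>
  define T where "T p \<phi> = (\<lambda>m. \<Sum>\<alpha>\<in>mons r d. p \<alpha> * \<phi> (m + \<alpha>))"
    for p and \<phi> :: "(nat \<Rightarrow>\<^sub>0 nat) \<Rightarrow> 'k"
  have T: "act F = T (Poly_Mapping.lookup F)" if "F \<in> forms r d" for F
    using that ev_superset[of "mons r d" F] by (intro ext) (simp add: act_def T_def forms_iff)
  have lin: "flinear (T p)" for p
    by (rule flinearI) (simp_all add: T_def algebra_simps sum.distrib sum_distrib_left)
  have "gen (mons r d) (\<lambda>p. n \<le> fn.dim (T p ` V))"
  proof (rule gen_dim_image)
    show "(\<lambda>p. T p \<phi> x) \<in> polyfun (mons r d)" for \<phi> x
      unfolding T_def by (intro polyfun_sum polyfun_mult polyfun_coord polyfun_const)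
    show "n \<le> fn.dim (T (Poly_Mapping.lookup F0) ` V)" using assms T by simp
  qed (rule fn2.fin_dim_image[OF lin assms(3)])
  then show ?thesis using T by (intro exI[of _ "\<lambda>p. n \<le> fn.dim (T p ` V)"]) auto
qed

subsection \<open>The Maximal Rank Property\<close>

text \<open>Macaulay's bound: contraction maps the inverse system in degree \<open>Suc j\<close>
  into the one in degree \<open>j\<close>, with rank at least Green's number.\<close>

lemma mac_hilb_le:
  fixes I :: "'k::field_char_0 mpoly set"
  assumes I: "homogeneous_ideal r I"
  shows "mac (Suc j) (hilb r I (Suc j)) \<le> hilb r I j"
proof -
  let ?V = "ann r I (Suc j)"
  obtain a where "mac (Suc j) (fn.dim ?V) \<le> fn.dim (lact r a ` ?V)"
    using green[OF subspace_ann ann_subset] by blast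
  also have "lact r a ` ?V \<subseteq> ann r I j"
    using act_ann[OF I lform_forms[of r a], of _ j] by (auto simp: act_lform)
  then have "fn.dim (lact r a ` ?V) \<le> fn.dim (ann r I j)"
    by (rule fn.fin_dim_mono[OF fin_dim_ann])
  finally show ?thesis by (simp add: hilb_eq_dim_ann[OF I])
qed

lemma hilb_le_mcount:
  assumes I: "homogeneous_ideal r I"
  shows "hilb r I d \<le> mcount r d"
proof -
  have "fn.dim (ann r I d) \<le> fn.dim (fsupp (mons r d) :: ((nat \<Rightarrow>\<^sub>0 nat) \<Rightarrow> 'a) set)"
    by (rule fn.fin_dim_mono[OF fin_dim_fsupp[OF finite_mons] ann_subset])
  also have "\<dots> \<le> card (mons r d)" by (rule dim_fsupp_le) simp
  finally show ?thesis by (simp add: hilb_eq_dim_ann[OF I] card_mons)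
qed

section \<open>Sufficient conditions for maximal rank\<close>

text \<open>From degree \<open>N\<close> on the target is zero, so only finitely many open
  conditions are intersected, each nonempty by \<open>ex\<close>.\<close>

lemma MRP_I:
  fixes I :: "'k::field_char_0 mpoly set"
  assumes I: "homogeneous_ideal r I" and N: "\<And>j. N \<le> j \<Longrightarrow> hilb r I j = 0"
    and ex: "\<And>d i. 1 \<le> d \<Longrightarrow> \<exists>F\<in>forms r d. min (hilb r I i) (hilb r I (i + d)) \<le> fn.dim (act F ` ann r I (i + d))"
  shows "MRP r I"
  unfolding MRP_def
proof (intro allI impI)
  fix d :: nat assume d: "1 \<le> d"
  have mr: "mult_max_rank r I F d i"
    if "F \<in> forms r d" "min (hilb r I i) (hilb r I (i + d)) \<le> fn.dim (act F ` ann r I (i + d))" for F i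
    using that mult_max_rank_injI[OF I] mult_max_rank_surjI[OF I] by (metis min_def)
  have "\<exists>P. gen (mons r d) P \<and> (\<forall>F\<in>forms r d. P (Poly_Mapping.lookup F) \<longrightarrow> mult_max_rank r I F d i)" for i
  proof -
    obtain F0 where F0: "F0 \<in> forms r d" "min (hilb r I i) (hilb r I (i + d)) \<le> fn.dim (act F0 ` ann r I (i + d))"
      using ex[OF d] by blast
    then show ?thesis using gen_dim_act[OF F0 fin_dim_ann] mr by blast
  qed
  then have "\<forall>i. \<exists>P. gen (mons r d) P \<and> (\<forall>F\<in>forms r d. P (Poly_Mapping.lookup F) \<longrightarrow> mult_max_rank r I F d i)"
    by blast
  from choice[OF this] obtain P where P: "\<And>i. gen (mons r d) (P i)"
    "\<And>i F. F \<in> forms r d \<Longrightarrow> P i (Poly_Mapping.lookup F) \<Longrightarrow> mult_max_rank r I F d i" by blast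
  show "general_form r d (\<lambda>F. \<forall>i. mult_max_rank r I F d i)"
  proof (rule gen_general_form)
    show "gen (mons r d) (\<lambda>p. \<forall>i<N. P i p)" using P(1) by (rule gen_ball)
    fix F assume F: "F \<in> forms r d" "\<forall>i<N. P i (Poly_Mapping.lookup F)"
    show "\<forall>i. mult_max_rank r I F d i"
    proof
      fix i show "mult_max_rank r I F d i"
      proof (cases "i < N")
        case True
        then show ?thesis using F P(2) by blast
      next
        case False
        then show ?thesis using N[of "i + d"] by (intro mult_max_rank_surjI[OF I F(1)]) simp
      qed
    qed
  qed
qed

text \<open>Green's bound sustains \<open>min ?c (Suc j)\<close>, because \<open>mac\<close> is the
  identity on numbers up to the degree. At \<open>j = i\<close> this dominates the required rank as
  soon as one of the two values is at most \<open>Suc i\<close>.\<close>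

lemma act_rank_small:
  fixes I :: "'k::field_char_0 mpoly set"
  assumes I: "homogeneous_ideal r I" and small: "hilb r I i \<le> Suc i \<or> hilb r I (i + d) \<le> Suc i"
  shows "\<exists>F\<in>forms r d. min (hilb r I i) (hilb r I (i + d)) \<le> fn.dim (act F ` ann r I (i + d))"
proof -
  let ?c = "hilb r I (i + d)"
  have "\<exists>F\<in>forms r d. min ?c (Suc i) \<le> fn.dim (act F ` ann r I (i + d))"
  proof (rule green_iterate[where b = "\<lambda>j. min ?c (Suc j)", OF subspace_ann ann_subset])
    show "min ?c (Suc (i + d)) \<le> fn.dim (ann r I (i + d))" by (simp add: hilb_eq_dim_ann[OF I])
    show "min ?c (Suc j) \<le> mac (Suc j) (min ?c (Suc (Suc j)))" for j
      using mac_ge_min[of "min ?c (Suc (Suc j))" "Suc j"] by simp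
  qed
  then obtain F where F: "F \<in> forms r d" "min ?c (Suc i) \<le> fn.dim (act F ` ann r I (i + d))" by blast
  moreover have "min (hilb r I i) ?c \<le> min ?c (Suc i)" using small by auto
  ultimately show ?thesis using order_trans by blast
qed

lemma Least_le_self_greater: "i < (LEAST t. h t \<le> t) \<Longrightarrow> i < h i" for h :: "nat \<Rightarrow> nat"
  using not_less_Least by fastforce

lemma MRP_two_vars:
  fixes I :: "'k::field_char_0 mpoly set"
  assumes I: "homogeneous_ideal 2 I" and N: "\<And>j. N \<le> j \<Longrightarrow> hilb 2 I j = 0"
  shows "MRP 2 I"
proof (rule MRP_I[OF I N])
  fix d i :: nat
  show "\<exists>F\<in>forms 2 d. min (hilb 2 I i) (hilb 2 I (i + d)) \<le> fn.dim (act F ` ann 2 I (i + d))"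
    using hilb_le_mcount[OF I, of i] by (intro act_rank_small[OF I]) (simp add: mcount_2)
qed

lemma MRP_extremal:
  fixes I :: "'k::field_char_0 mpoly set"
  assumes I: "homogeneous_ideal r I" and N: "\<And>j. N \<le> j \<Longrightarrow> hilb r I j = 0"
    and h: "hilb r I 0 = 1" and t: "2 \<le> t" "hilb r I t \<le> 2"
    and ext: "\<And>j. Suc j < t \<Longrightarrow> hilb r I j \<le> mac (Suc j) (hilb r I (Suc j))"
  shows "MRP r I"
proof (rule MRP_I[OF I N])
  fix d i :: nat
  have tail: "hilb r I j \<le> 2" if "t \<le> j" for j
    using that
  proof (induction j rule: dec_induct)
    case (step j)
    show ?case
    proof (rule ccontr)
      assume "\<not> ?thesis"
      \<comment> \<open>Since \<open>Suc j\<close> is at least 3, \<open>mac (Suc j) 3\<close> is 3: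
        a value above 2 in degree \<open>Suc j\<close> would force one in degree
        \<open>j\<close>.\<close>
      then have "mac (Suc j) 3 \<le> mac (Suc j) (hilb r I (Suc j))" by (intro mac_mono) simp
      also have "\<dots> \<le> hilb r I j" by (rule mac_hilb_le[OF I])
      finally show False using step t mac_small[of 3 "Suc j"] by simp
    qed
  qed (use t in simp)
  show "\<exists>F\<in>forms r d. min (hilb r I i) (hilb r I (i + d)) \<le> fn.dim (act F ` ann r I (i + d))"
  proof (cases "i + d < t")
    case True
    have "\<exists>F\<in>forms r d. hilb r I i \<le> fn.dim (act F ` ann r I (i + d))"
      using True ext by (intro green_iterate[where b = "hilb r I", OF subspace_ann ann_subset])
        (auto simp: hilb_eq_dim_ann[OF I])
    then show ?thesis by (meson min.coboundedI1)
  next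
    case False
    then have "hilb r I (i + d) \<le> 2" by (intro tail) simp
    \<comment> \<open>For positive \<open>i\<close> the target is at most 2; for
      \<open>i = 0\<close> the source has dimension 1.\<close>
    then have "hilb r I i \<le> Suc i \<or> hilb r I (i + d) \<le> Suc i" using h by (cases i) auto
    then show ?thesis by (rule act_rank_small[OF I])
  qed
qed

section \<open>Monomial ideals and obstructions to maximal rank\<close>

text \<open>\<open>T\<close> lists the monomials outside the ideal; closure of \<open>T\<close>
  under divisors is what makes this an ideal.\<close>

definition mono_ideal :: "nat \<Rightarrow> (nat \<Rightarrow>\<^sub>0 nat) set \<Rightarrow> 'k::field mpoly set" where
  "mono_ideal r T = {f \<in> polys r. Poly_Mapping.keys f \<inter> T = {}}"

lemma lookup_hcomp:
  "Poly_Mapping.lookup (hcomp d f) \<alpha> = (if mdeg \<alpha> = d then Poly_Mapping.lookup f \<alpha> else 0)"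
proof -
  have "finite {\<alpha>. (if mdeg \<alpha> = d then Poly_Mapping.lookup f \<alpha> else 0) \<noteq> 0}"
    by (rule finite_subset[OF _ finite_lookup[of f]]) auto
  then show ?thesis unfolding hcomp_def by simp
qed

lemma homogeneous_mono_ideal:
  fixes T :: "(nat \<Rightarrow>\<^sub>0 nat) set"
  assumes "\<And>\<alpha> \<beta>. \<alpha> + \<beta> \<in> T \<Longrightarrow> \<beta> \<in> T"
  shows "homogeneous_ideal r (mono_ideal r T :: 'k::field mpoly set)"
  unfolding homogeneous_ideal_def
proof (intro conjI ballI allI)
  show "mono_ideal r T \<subseteq> polys r" "0 \<in> mono_ideal r T" by (auto simp: mono_ideal_def polys_def)
  fix f g :: "'k mpoly" assume f: "f \<in> mono_ideal r T"
  show "f + g \<in> mono_ideal r T" if "g \<in> mono_ideal r T"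
    using f that keys_add[of f g] by (fastforce simp: mono_ideal_def polys_def)
  show "g * f \<in> mono_ideal r T" if g: "g \<in> polys r"
  proof -
    have "Poly_Mapping.keys \<gamma> \<subseteq> {..<r} \<and> \<gamma> \<notin> T" if \<gamma>: "\<gamma> \<in> Poly_Mapping.keys (g * f)" for \<gamma>
    proof -
      obtain \<alpha> \<beta> where "\<gamma> = \<alpha> + \<beta>" "\<alpha> \<in> Poly_Mapping.keys g" "\<beta> \<in> Poly_Mapping.keys f"
        using \<gamma> keys_mult[of g f] by blast
      then show ?thesis using f g assms by (auto simp: mono_ideal_def polys_def keys_add_nat)
    qed
    then show ?thesis by (auto simp: mono_ideal_def polys_def)
  qed
  show "hcomp d f \<in> mono_ideal r T" for d
    using f by (auto simp: mono_ideal_def polys_def in_keys_iff lookup_hcomp disjoint_iff split: if_splits)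
qed

lemma lookup_const_times:
  "Poly_Mapping.lookup (const c * f) \<alpha> = c * Poly_Mapping.lookup f \<alpha>" for f :: "'k::field mpoly"
proof -
  have ev: "ev (\<lambda>\<beta>. if \<beta> = \<alpha> then 1 else 0) f = Poly_Mapping.lookup f \<alpha>" for f :: "'k mpoly"
    by (simp add: ev_def in_keys_iff if_distrib cong: if_cong)
  show ?thesis using ev_const_times[of "\<lambda>\<beta>. if \<beta> = \<alpha> then 1 else 0" c f] unfolding ev .
qed

lemma lin_sub_mono_ideal: "lin_sub (mono_ideal r T :: 'k::field mpoly set)"
  unfolding lin_sub_def
proof (intro conjI ballI allI)
  show "0 \<in> (mono_ideal r T :: 'k mpoly set)" by (simp add: mono_ideal_def polys_def)
  fix f g :: "'k mpoly" and c assume f: "f \<in> mono_ideal r T"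
  have "Poly_Mapping.keys (const c * f) \<subseteq> Poly_Mapping.keys f" by (auto simp: in_keys_iff lookup_const_times)
  then show "const c * f \<in> mono_ideal r T" using f by (fastforce simp: mono_ideal_def polys_def)
  assume "g \<in> mono_ideal r T"
  then show "f + g \<in> mono_ideal r T"
    using f keys_add[of f g] by (fastforce simp: mono_ideal_def polys_def)
qed

lemma mono_ideal_lookup:
  "f \<in> mono_ideal r T \<Longrightarrow> \<alpha> \<in> T \<Longrightarrow> Poly_Mapping.lookup f \<alpha> = 0"
  by (auto simp: mono_ideal_def in_keys_iff)

lemma hilb_mono_ideal:
  fixes T :: "(nat \<Rightarrow>\<^sub>0 nat) set"
  assumes T: "\<And>\<alpha> \<beta>. \<alpha> + \<beta> \<in> T \<Longrightarrow> \<beta> \<in> T"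
  shows "hilb r (mono_ideal r T :: 'k::field mpoly set) d = card (T \<inter> mons r d)"
proof -
  let ?I = "mono_ideal r T :: 'k mpoly set" and ?x = "\<lambda>m. Poly_Mapping.single m (1::'k)"
  let ?S = "T \<inter> mons r d"
  have I: "homogeneous_ideal r ?I" using T by (rule homogeneous_mono_ideal)
  have inj: "inj_on ?x ?S" by (intro inj_onI) (metis keys_single singleton_inject zero_neq_one)
  have sum: "(\<Sum>b\<in>?x ` ?S. const (c b) * b) = (\<Sum>m\<in>?S. Poly_Mapping.single m (c (?x m)))" for c
    by (simp add: sum.reindex[OF inj] const_times_single)
  have lk: "Poly_Mapping.lookup (\<Sum>m\<in>?S. Poly_Mapping.single m (c m)) \<alpha> = (if \<alpha> \<in> ?S then c \<alpha> else 0)" for c :: "_ \<Rightarrow> 'k" and \<alpha>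
  proof -
    have "Poly_Mapping.lookup (\<Sum>m\<in>?S. Poly_Mapping.single m (c m)) \<alpha> = (\<Sum>m\<in>?S. if m = \<alpha> then c m else 0)"
      unfolding lookup_sum by (intro sum.cong) (auto simp: lookup_single when_def)
    then show ?thesis by simp
  qed
  have "basis_mod r ?I d (?x ` ?S)"
    unfolding basis_mod_def
  proof (intro conjI allI impI ballI)
    show "finite (?x ` ?S)" by simp
    show "?x ` ?S \<subseteq> forms r d" by (auto intro: forms_single)
  next
    fix c b assume c: "(\<Sum>b\<in>?x ` ?S. const (c b) * b) \<in> ?I" and "b \<in> ?x ` ?S"
    then obtain m where m: "m \<in> ?S" "b = ?x m" by blast
    then have "Poly_Mapping.lookup (\<Sum>m\<in>?S. Poly_Mapping.single m (c (?x m))) m = 0"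
      using c mono_ideal_lookup unfolding sum by blast
    then show "c b = 0" using m lk[of "\<lambda>m. c (?x m)" m] by simp
  next
    fix f :: "'k mpoly" assume f: "f \<in> forms r d"
    define c where "c b = Poly_Mapping.lookup f (inv_into ?S ?x b)" for b
    have c: "c (?x m) = Poly_Mapping.lookup f m" if "m \<in> ?S" for m
      unfolding c_def using inv_into_f_f[OF inj that] by simp
    define g where "g = f - (\<Sum>m\<in>?S. Poly_Mapping.single m (c (?x m)))"
    have g: "Poly_Mapping.lookup g \<alpha> = (if \<alpha> \<in> ?S then 0 else Poly_Mapping.lookup f \<alpha>)" for \<alpha>
      unfolding g_def lookup_minus lk[of "\<lambda>m. c (?x m)"] using c by simp
    have "g \<in> mono_ideal r T"
      using f g unfolding mono_ideal_def polys_def forms_iff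
      by (auto simp: in_keys_iff mons_def split: if_splits)
    then show "\<exists>c. f - (\<Sum>b\<in>?x ` ?S. const (c b) * b) \<in> ?I"
      unfolding g_def sum by blast
  qed
  then have "fn.dim (ann r ?I d) = card (?x ` ?S)"
    by (rule basis_mod_dual(1)[OF lin_sub_mono_ideal])
  then show ?thesis by (simp add: hilb_eq_dim_ann[OF I] card_image[OF inj])
qed

lemma three_vectors_in_plane:
  fixes p0 p1 p2 q0 q1 q2 :: "'k::field"
  shows "\<exists>c0 c1 c2. (c0 \<noteq> 0 \<or> c1 \<noteq> 0 \<or> c2 \<noteq> 0) \<and>
    c0 * p0 + c1 * p1 + c2 * p2 = 0 \<and> c0 * q0 + c1 * q1 + c2 * q2 = 0"
proof -
  consider "p0 = 0" "q0 = 0" | "p0 * q1 - p1 * q0 \<noteq> 0" | "p0 * q1 - p1 * q0 = 0" "p0 \<noteq> 0" | "p0 * q1 - p1 * q0 = 0" "q0 \<noteq> 0"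
    by blast
  then show ?thesis
  proof cases
    case 1
    then show ?thesis by (intro exI[of _ 1] exI[of _ 0]) simp
  next
    case 2
    then show ?thesis
      \<comment> \<open>The cross product of the rows \<open>p\<close> and \<open>q\<close>. In the
        two remaining cases the first two columns are already dependent.\<close>
      by (intro exI[of _ "p1 * q2 - p2 * q1"] exI[of _ "p2 * q0 - p0 * q2"] exI[of _ "p0 * q1 - p1 * q0"])
        (simp add: algebra_simps)
  next
    case 3
    then show ?thesis
      by (intro exI[of _ "- p1"] exI[of _ p0] exI[of _ 0]) (simp add: algebra_simps)
  next
    case 4
    then show ?thesis
      by (intro exI[of _ "- q1"] exI[of _ q0] exI[of _ 0]) (simp add: algebra_simps)
  qed
qed

lemma evar_eq_iff: "evar i = evar j \<longleftrightarrow> i = j"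
  by (metis keys_single nat.distinct(1) singleton_inject)

lemma mons_deg_1: "\<alpha> \<in> mons r (Suc 0) \<Longrightarrow> \<exists>j<r. \<alpha> = evar j"
  by (elim mons_Suc_exists) auto

lemma MRP_imp_ex:
  assumes "MRP r I" "1 \<le> d"
  shows "\<exists>F\<in>forms r d. mult_max_rank r I F d i"
  using assms unfolding MRP_def general_form_def by blast

lemma in_mono_ideal:
  assumes "f \<in> forms r d" "\<And>\<alpha>. \<alpha> \<in> Poly_Mapping.keys f \<Longrightarrow> \<alpha> \<notin> T"
  shows "f \<in> mono_ideal r T"
  using assms forms_subset_polys by (auto simp: mono_ideal_def)

lemma not_MRP_socle:
  fixes T :: "(nat \<Rightarrow>\<^sub>0 nat) set"
  assumes r: "2 \<le> r" and T: "mons 2 (Suc i) \<subseteq> T"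
    and m: "m \<in> T" "m \<in> mons r i" "\<And>j. j < r \<Longrightarrow> m + evar j \<notin> T"
  shows "\<not> MRP r (mono_ideal r T :: 'k::field mpoly set)"
proof
  let ?I = "mono_ideal r T :: 'k mpoly set"
  assume "MRP r ?I"
  then obtain L where L: "L \<in> forms r 1" and rk: "mult_max_rank r ?I L 1 i"
    using MRP_imp_ex[of r ?I 1 i] by auto
  let ?m = "Poly_Mapping.single m (1::'k)"
  have mf: "?m \<in> forms r i" using m(2) by (rule forms_single)
  have "\<alpha> \<notin> T" if \<alpha>: "\<alpha> \<in> Poly_Mapping.keys (L * ?m)" for \<alpha>
  proof -
    obtain \<beta> where \<beta>: "\<beta> \<in> Poly_Mapping.keys L" "\<alpha> = \<beta> + m" using \<alpha> keys_mult[of L ?m] by auto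
    then have "\<beta> \<in> mons r (Suc 0)" using L by (auto simp: forms_iff)
    then obtain j where "j < r" "\<beta> = evar j" using mons_deg_1 by blast
    then show ?thesis using m(3) \<beta> by (simp add: add.commute)
  qed
  then have "L * ?m \<in> ?I" using forms_mult[OF L mf] by (rule in_mono_ideal[rotated])
  moreover have "?m \<notin> ?I" using m(1) by (simp add: mono_ideal_def)
  ultimately have surj: "\<forall>h\<in>forms r (i + 1). \<exists>g\<in>forms r i. h - L * g \<in> ?I"
    using rk mf unfolding mult_max_rank_def by blast
  txt \<open>Evaluation at a point of the line \<open>x\<^sub>2 = x\<^sub>3 = \<dots> = 0\<close> where \<open>L\<close> vanishes kills the ideal in
    degree \<open>i + 1\<close> and all multiples of \<open>L\<close>.\<close>
  define a where "a = Poly_Mapping.lookup L (evar 0)"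
  define b where "b = Poly_Mapping.lookup L (evar 1)"
  \<comment> \<open>The point \<open>(b, -a)\<close> is a zero of \<open>L\<close> on the line,
    unless \<open>L\<close> vanishes identically there; then \<open>(1, 0)\<close> is taken.\<close>
  define u where "u = (if a = 0 \<and> b = 0 then 1 else b)"
  define v where "v = - a"
  have uv: "u \<noteq> 0 \<or> v \<noteq> 0" and abuv: "a * u + b * v = 0" by (auto simp: u_def v_def)
  \<comment> \<open>Evaluation at the point with first coordinates \<open>u\<close>,
    \<open>v\<close> and all others zero.\<close>
  define \<psi> where "\<psi> \<alpha> = (if Poly_Mapping.keys \<alpha> \<subseteq> {..<2} then u ^ Poly_Mapping.lookup \<alpha> 0 * v ^ Poly_Mapping.lookup \<alpha> 1 else 0)"
    for \<alpha> :: "nat \<Rightarrow>\<^sub>0 nat"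
  have hom: "\<psi> (\<alpha> + \<beta>) = \<psi> \<alpha> * \<psi> \<beta>" for \<alpha> \<beta>
    by (simp add: \<psi>_def keys_add_nat lookup_add power_add)
  have "ev \<psi> L = (\<Sum>\<alpha>\<in>{evar 0, evar 1}. Poly_Mapping.lookup L \<alpha> * \<psi> \<alpha>)"
    unfolding ev_def
  proof (rule sum.mono_neutral_cong)
    fix \<alpha> assume "\<alpha> \<in> Poly_Mapping.keys L - {evar 0, evar 1}"
    moreover from this have "\<alpha> \<in> mons r (Suc 0)" using L by (auto simp: forms_iff)
    then obtain j where j: "\<alpha> = evar j" using mons_deg_1 by blast
    ultimately have "j \<notin> {0, 1}" by (intro notI) auto
    then show "Poly_Mapping.lookup L \<alpha> * \<psi> \<alpha> = 0" using j by (simp add: \<psi>_def)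
  qed (auto simp: in_keys_iff)
  also have "\<dots> = a * u + b * v"
    by (simp add: a_def b_def \<psi>_def lookup_single evar_eq_iff)
  finally have L0: "ev \<psi> L = 0" using abuv by simp
  \<comment> \<open>Surjectivity would make every form of degree \<open>Suc i\<close> vanish at the
    point, contradicted by the powers of the first two variables.\<close>
  have h0: "ev \<psi> h = 0" if h: "h \<in> forms r (Suc i)" for h
  proof -
    obtain g where g: "g \<in> forms r i" "h - L * g \<in> ?I" using surj h by auto
    have "L * g \<in> forms r (Suc i)" using forms_mult[OF L g(1)] by simp
    then have hg: "h - L * g \<in> forms r (Suc i)" using h by (rule forms_diff[rotated])
    have "\<psi> \<alpha> = 0" if \<alpha>: "\<alpha> \<in> Poly_Mapping.keys (h - L * g)" for \<alpha>
    proof -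
      have "\<alpha> \<notin> T" using g(2) \<alpha> by (auto simp: mono_ideal_def)
      then have "\<alpha> \<notin> mons 2 (Suc i)" using T by blast
      moreover have "mdeg \<alpha> = Suc i" using hg \<alpha> by (auto simp: forms_iff mons_def)
      ultimately show ?thesis by (auto simp: \<psi>_def mons_def)
    qed
    then have "ev \<psi> (h - L * g) = 0" unfolding ev_def by (intro sum.neutral) simp
    then show ?thesis using ev_mult_hom[of \<psi> L g, OF hom] L0 by (simp add: ev_diff)
  qed
  have "ev \<psi> (Poly_Mapping.single (Poly_Mapping.single 0 (Suc i)) 1) = u ^ Suc i"
    "ev \<psi> (Poly_Mapping.single (Poly_Mapping.single 1 (Suc i)) 1) = v ^ Suc i"
    by (simp_all add: \<psi>_def lookup_single)
  moreover have "Poly_Mapping.single j (Suc i) \<in> mons r (Suc i)" if "j < 2" for j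
    using that r by (simp add: mons_def mdeg_def)
  then have "Poly_Mapping.single (Poly_Mapping.single j (Suc i)) 1 \<in> forms r (Suc i)" if "j < 2" for j
    using that by (intro forms_single)
  then have "ev \<psi> (Poly_Mapping.single (Poly_Mapping.single j (Suc i)) 1) = 0" if "j < 2" for j
    using that h0 by blast
  from this[of 0] this[of 1] have
    "ev \<psi> (Poly_Mapping.single (Poly_Mapping.single 0 (Suc i)) 1) = 0"
    "ev \<psi> (Poly_Mapping.single (Poly_Mapping.single 1 (Suc i)) 1) = 0" by simp_all
  ultimately have "u ^ Suc i = 0" "v ^ Suc i = 0" by metis+
  then show False using uv by auto
qed

text \<open>In degree \<open>t\<close> only monomials in two variables survive, so multiplication from degree 1 to
  degree \<open>t\<close> factors through a plane.\<close>

lemma not_MRP_three: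
  fixes T :: "(nat \<Rightarrow>\<^sub>0 nat) set"
  assumes r: "2 < r" and t: "2 \<le> t" and T: "T \<inter> mons r t \<subseteq> mons 2 t" "3 \<le> card (T \<inter> mons r t)"
    and T1: "evar 2 \<in> T"
  shows "\<not> MRP r (mono_ideal r T :: 'k::field mpoly set)"
proof
  let ?I = "mono_ideal r T :: 'k mpoly set"
  assume "MRP r ?I"
  then obtain F where F: "F \<in> forms r (t - 1)" and rk: "mult_max_rank r ?I F (t - 1) 1"
    using MRP_imp_ex[of r ?I "t - 1" 1] t by force
  \<comment> \<open>Each monomial of such a product involves a variable of index at least 2, so none
    survives in degree \<open>t\<close>. The variable of index 2 then refutes injectivity.\<close>
  have kill: "F * g \<in> ?I" if g: "g \<in> forms r 1" "Poly_Mapping.lookup g (evar 0) = 0" "Poly_Mapping.lookup g (evar 1) = 0" for g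
  proof (rule in_mono_ideal)
    show Fg: "F * g \<in> forms r t" using forms_mult[OF F g(1)] t by simp
    fix \<alpha> assume \<alpha>: "\<alpha> \<in> Poly_Mapping.keys (F * g)"
    then obtain \<beta> \<gamma> where \<beta>\<gamma>: "\<alpha> = \<beta> + \<gamma>" "\<gamma> \<in> Poly_Mapping.keys g" using keys_mult[of F g] by blast
    then have "\<gamma> \<in> mons r (Suc 0)" using g(1) by (auto simp: forms_iff)
    then obtain j where j: "\<gamma> = evar j" using mons_deg_1 by blast
    have "j \<notin> {0, 1}" using g(2,3) \<beta>\<gamma>(2) j by (intro notI) (auto simp: in_keys_iff)
    then have "\<alpha> \<notin> mons 2 t" using \<beta>\<gamma>(1) j by (auto simp: mons_def keys_add_nat)
    moreover have "\<alpha> \<in> mons r t" using Fg \<alpha> by (auto simp: forms_iff)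
    ultimately show "\<alpha> \<notin> T" using T(1) by blast
  qed
  let ?z = "Poly_Mapping.single (evar 2) (1::'k)"
  have "?z \<in> forms r 1" using r by (intro forms_single) (simp add: mons_def)
  moreover from this have "F * ?z \<in> ?I"
    by (rule kill) (simp_all add: lookup_single evar_eq_iff when_def)
  moreover have "?z \<notin> ?I" using T1 by (simp add: mono_ideal_def)
  ultimately have surj: "\<forall>h\<in>forms r (1 + (t - 1)). \<exists>g\<in>forms r 1. h - F * g \<in> ?I"
    using rk unfolding mult_max_rank_def by blast
  obtain S where S: "S \<subseteq> T \<inter> mons r t" "card S = 3" using obtain_subset_with_card_n[OF T(2)] by blast
  obtain m0 m1 m2 where m: "S = {m0, m1, m2}" "m0 \<noteq> m1" "m0 \<noteq> m2" "m1 \<noteq> m2"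
    using S(2) by (auto simp: card_3_iff)
  let ?x = "\<lambda>m. Poly_Mapping.single m (1::'k)"
  have mem: "m0 \<in> T" "m1 \<in> T" "m2 \<in> T" "m0 \<in> mons r t" "m1 \<in> mons r t" "m2 \<in> mons r t" using S m by auto
  have ex: "\<exists>g\<in>forms r 1. ?x m - F * g \<in> ?I" if "m \<in> mons r t" for m
  proof -
    have "1 + (t - 1) = t" using t by simp
    then show ?thesis using surj forms_single[OF that, of 1] by metis
  qed
  obtain g0 g1 g2 where g: "g0 \<in> forms r 1" "?x m0 - F * g0 \<in> ?I" "g1 \<in> forms r 1" "?x m1 - F * g1 \<in> ?I"
     "g2 \<in> forms r 1" "?x m2 - F * g2 \<in> ?I"
    using ex[OF mem(4)] ex[OF mem(5)] ex[OF mem(6)] by blast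
  \<comment> \<open>The combination of the three preimages has no term in the first two variables,
    so \<open>F\<close> kills it, although the same combination of surviving monomials is
    nonzero.\<close>
  obtain c0 c1 c2 where c: "c0 \<noteq> 0 \<or> c1 \<noteq> 0 \<or> c2 \<noteq> 0"
    "c0 * Poly_Mapping.lookup g0 (evar 0) + c1 * Poly_Mapping.lookup g1 (evar 0) + c2 * Poly_Mapping.lookup g2 (evar 0) = 0"
    "c0 * Poly_Mapping.lookup g0 (evar 1) + c1 * Poly_Mapping.lookup g1 (evar 1) + c2 * Poly_Mapping.lookup g2 (evar 1) = 0"
    using three_vectors_in_plane by blast
  define g where "g = const c0 * g0 + const c1 * g1 + const c2 * g2"
  define w where "w = const c0 * ?x m0 + const c1 * ?x m1 + const c2 * ?x m2"
  have "g \<in> forms r 1" unfolding g_def using g by (intro forms_add forms_const_times)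
  then have "F * g \<in> ?I" by (rule kill) (use c in \<open>simp_all add: g_def lookup_add lookup_const_times\<close>)
  have "w = F * g + (const c0 * (?x m0 - F * g0) + const c1 * (?x m1 - F * g1) + const c2 * (?x m2 - F * g2))"
    unfolding w_def g_def by (simp add: algebra_simps)
  also have "\<dots> \<in> ?I" using g \<open>F * g \<in> ?I\<close> 
    by (intro lin_sub_add[OF lin_sub_mono_ideal] lin_sub_const[OF lin_sub_mono_ideal]) auto
  finally have "w \<in> ?I" .
  then have "Poly_Mapping.lookup w m0 = 0" "Poly_Mapping.lookup w m1 = 0" "Poly_Mapping.lookup w m2 = 0"
    using mem mono_ideal_lookup by blast+
  then show False using c(1) m(2-4) by (simp add: w_def lookup_add lookup_const_times lookup_single when_def)
qed

theorem theorem3p1: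
  fixes h :: "nat \<Rightarrow> nat" and r :: nat
  assumes r2: "r \<ge> 2"
    and h0: "h 0 = 1" and h1: "h 1 = r"
    and Oseq: "\<exists>I :: ('k::field_char_0) mpoly set.
                 homogeneous_ideal r I \<and> artinian r I \<and> (\<forall>d. hilb r I d = h d)"
  defines "t \<equiv> LEAST t. h t \<le> t"
  shows "(\<forall>I :: 'k mpoly set. homogeneous_ideal r I \<and> (\<forall>d. hilb r I d = h d) \<longrightarrow> MRP r I)
         \<longleftrightarrow> (r = 2 \<or> (r > 2 \<and> h t \<le> 2 \<and> (\<forall>i\<in>{1..t-1}. h (i - 1) = macaulay_mm (h i) i)))"
proof -
  obtain I0 :: "'k mpoly set" where I0: "homogeneous_ideal r I0" "artinian r I0" "\<And>d. hilb r I0 d = h d"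
    using Oseq by blast
  obtain N where N: "\<And>j. N \<le> j \<Longrightarrow> h j = 0" using I0(2,3) unfolding artinian_def by auto
  have mac_le: "mac (Suc j) (h (Suc j)) \<le> h j" for j using mac_hilb_le[OF I0(1), of j] I0(3) by simp
  have cnt: "h d \<le> mcount r d" for d using hilb_le_mcount[OF I0(1), of d] I0(3) by simp
  \<comment> \<open>This gives the \<open>LEAST\<close> defining \<open>t\<close> a witness.\<close>
  have "h N \<le> N" using N[of N] by simp
  then have ht: "h t \<le> t" unfolding t_def by (rule LeastI)
  have lt: "i < h i" if "i < t" for i using that unfolding t_def by (rule Least_le_self_greater)
  have mm: "macaulay_mm (h (Suc j)) (Suc j) = mac (Suc j) (h (Suc j))" if "Suc j < t" for j
    using lt[OF that] by (intro macaulay_mm_eq_mac) simp_all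
  have t2: "2 \<le> t" if "2 < r"
    using that ht h0 h1 by (cases "t = 0"; cases "t = 1") auto
  show ?thesis
  proof
    assume cond: "r = 2 \<or> (r > 2 \<and> h t \<le> 2 \<and> (\<forall>i\<in>{1..t-1}. h (i - 1) = macaulay_mm (h i) i))"
    show "\<forall>I :: 'k mpoly set. homogeneous_ideal r I \<and> (\<forall>d. hilb r I d = h d) \<longrightarrow> MRP r I"
    proof (intro allI impI, elim conjE)
      fix I :: "'k mpoly set" assume I: "homogeneous_ideal r I" and h: "\<forall>d. hilb r I d = h d"
      show "MRP r I"
      proof (cases "r = 2")
        case True
        then show ?thesis using MRP_two_vars[of I N] I h N by simp
      next
        case False
        then have r: "2 < r" and h2: "h t \<le> 2" and eq: "\<forall>i\<in>{1..t-1}. h (i - 1) = macaulay_mm (h i) i"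
          using cond by auto
        show ?thesis
        proof (rule MRP_extremal[OF I])
          show "hilb r I j \<le> mac (Suc j) (hilb r I (Suc j))" if "Suc j < t" for j
            using eq[rule_format, of "Suc j"] mm[OF that] that h by simp
        qed (use N h h0 h2 t2[OF r] in auto)
      qed
    qed
  next
    assume all: "\<forall>I :: 'k mpoly set. homogeneous_ideal r I \<and> (\<forall>d. hilb r I d = h d) \<longrightarrow> MRP r I"
    show "r = 2 \<or> (r > 2 \<and> h t \<le> 2 \<and> (\<forall>i\<in>{1..t-1}. h (i - 1) = macaulay_mm (h i) i))"
    proof (cases "r = 2")
      case False
      then have r: "2 < r" using r2 by simp
      define T where "T = {\<alpha>. \<alpha> \<in> seg (mdeg \<alpha>) (h (mdeg \<alpha>))}"
      have Tseg: "T \<inter> mons r d = seg d (h d)" for d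
        using seg_subset_mons[OF cnt, of d] mdeg_seg unfolding T_def mons_def by blast
      have segT: "seg d (h d) \<subseteq> T" for d using Tseg by blast
      have div1: "\<beta> \<in> T" if "\<beta> + evar j \<in> T" for \<beta> j
      proof -
        have "\<beta> + evar j \<in> seg (Suc (mdeg \<beta>)) (h (Suc (mdeg \<beta>)))"
          using that by (simp add: T_def mdeg_add)
        then have "\<beta> \<in> seg (mdeg \<beta>) (mac (Suc (mdeg \<beta>)) (h (Suc (mdeg \<beta>))))" by (rule seg_shadow)
        then show ?thesis using seg_mono[OF mac_le] unfolding T_def by blast
      qed
      \<comment> \<open>Closure under division by one variable extends to all divisors by induction
        on the degree of the cofactor.\<close>
      have dvd: "\<beta> \<in> T" if "\<alpha> + \<beta> \<in> T" for \<alpha> \<beta>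
        using that
      proof (induction "mdeg \<alpha>" arbitrary: \<alpha>)
        case 0
        then show ?case by simp
      next
        case (Suc n)
        then have "\<alpha> \<noteq> 0" by auto
        then obtain j where "j \<in> Poly_Mapping.keys \<alpha>" by (metis all_not_in_conv keys_eq_empty)
        then obtain \<gamma> where \<gamma>: "\<alpha> = \<gamma> + evar j" by (rule evar_dvd)
        then have "(\<gamma> + \<beta>) + evar j \<in> T" using Suc.prems by (simp add: ac_simps)
        then have "\<gamma> + \<beta> \<in> T" by (rule div1)
        then show ?case using Suc.hyps \<gamma> by (simp add: mdeg_add)
      qed
      let ?I = "mono_ideal r T :: 'k mpoly set"
      have "homogeneous_ideal r ?I" using dvd by (rule homogeneous_mono_ideal)
      moreover have "hilb r ?I d = h d" for d
        using hilb_mono_ideal[of T r d, OF dvd] card_seg[OF cnt] by (simp add: Tseg)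
      ultimately have M: "MRP r ?I" using all by blast
      have "h t \<le> 2"
      proof (rule ccontr)
        assume "\<not> h t \<le> 2"
        \<comment> \<open>There are \<open>Suc t\<close> monomials of degree \<open>t\<close> in two
          variables, so the segment in degree \<open>t\<close> stays among them.\<close>
        have "h t \<le> mcount 2 t" using ht by (simp add: mcount_2)
        then have "T \<inter> mons r t \<subseteq> mons 2 t" unfolding Tseg by (rule seg_subset_mons)
        moreover have "3 \<le> card (T \<inter> mons r t)"
          unfolding Tseg card_seg[OF cnt] using \<open>\<not> h t \<le> 2\<close> by simp
        moreover have "seg (Suc 0) (h (Suc 0)) = mons r (Suc 0)"
          using seg_mcount[of "Suc 0" r] h1 by (simp add: mcount_deg_1)
        then have "evar 2 \<in> T" using segT[of "Suc 0"] r by (auto simp: mons_def)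
        ultimately show False using not_MRP_three[OF r t2[OF r]] M by blast
      qed
      moreover have "h (i - 1) = macaulay_mm (h i) i" if i: "i \<in> {1..t-1}" for i
      proof (rule ccontr)
        assume ne: "h (i - 1) \<noteq> macaulay_mm (h i) i"
        obtain k where k: "i = Suc k" using i by (cases i) auto
        then have kt: "Suc k < t" using i by auto
        have "mac (Suc k) (h (Suc k)) < h k" using ne mm[OF kt] mac_le[of k] k by simp
        \<comment> \<open>Counting leaves a monomial of the segment in degree \<open>k\<close> that
          divides nothing in the segment above.\<close>
        then have "\<not> seg k (h k) \<subseteq> seg k (mac (Suc k) (h (Suc k)))"
          using card_seg[OF cnt, of k] card_seg[of "mac (Suc k) (h (Suc k))" r k] cnt[of k]
          by (metis card_mono finite_mons finite_subset leD le_trans less_imp_le seg_subset_mons)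
        then obtain m where m: "m \<in> seg k (h k)" "m \<notin> seg k (mac (Suc k) (h (Suc k)))" by blast
        have "\<not> MRP r ?I"
        proof (rule not_MRP_socle[OF r2])
          \<comment> \<open>Below \<open>t\<close> the value \<open>h (Suc k)\<close> is at least
            \<open>Suc (Suc k)\<close>, so all monomials in two variables survive in degree
            \<open>Suc k\<close>.\<close>
          have "seg (Suc k) (mcount 2 (Suc k)) \<subseteq> seg (Suc k) (h (Suc k))"
            using lt[OF kt] by (intro seg_mono) (simp add: mcount_2)
          then show "mons 2 (Suc k) \<subseteq> T" using segT[of "Suc k"] by (auto simp: seg_mcount)
          show "m \<in> T" "m \<in> mons r k" using m(1) Tseg[of k] by auto
          show "m + evar j \<notin> T" for j
          proof
            assume "m + evar j \<in> T"
            then have "m + evar j \<in> seg (Suc k) (h (Suc k))"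
              using mdeg_seg[OF m(1)] by (simp add: T_def mdeg_add)
            then show False using seg_shadow m(2) by blast
          qed
        qed
        then show False using M by blast
      qed
      ultimately show ?thesis using r by blast
    qed simp
  qed
qed

end
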